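(* Consider an instance of the Lipschitz MAB problem. Fix any $c>0$ and let $d$ be the zooming dimension of the instance with multiplier $c$. Then the regret of the zooming algorithm satisfies $R(t)\le O(c\log t)^{\frac{1}{d+2}}\times t^{\frac{d+1}{d+2}}$ for all times $t$, where $O(\cdot)$ hides an absolute constant.
   Context: Lipschitz MAB problem: a metric space $(X,\mathcal{D})$ of diameter at most $1$ is known; the instance is an unknown $\mu:X\to[0,1]$ with $|\mu(x)-\mu(y)|\le\mathcal{D}(x,y)$, and for each arm $x$ a reward distribution on $[0,1]$ with mean $\mu(x)$; each round the algorithm picks $x_t$ and gets an independent reward from $x_t$'s distribution. Regret $R(t)=t\mu^*-\mathbb{E}[\sum_{s\le t}\mu(x_s)]$ where $\mu^*=\sup_x\mu(x)$; $\Delta(x)=\mu^*-\mu(x)$. $B(x,r)=\{y:\mathcal{D}(x,y)<r\}$. Zooming algorithm: it runs in phases $i=1,2,\dots$, phase $i$ lasting $2^i$ rounds and starting from scratch with no active arms. In phase $i_{ph}$ at time $t$, $n_t(x)$ is the number of times $x$ was played in this phase before $t$, $\mu_t(x)$ the average reward of those plays ($0$ if none), and $r_t(x)=\sqrt{8 i_{ph}/(1+n_t(x))}$. An arm is covered at time $t$ if it lies in $B(y,r_t(y))$ for some active arm $y$. In each round: (activation) if some arm is not covered, pick any such arm and make it active (it stays active until the end of the phase); (selection) play an active arm maximizing $I_t(x)=\mu_t(x)+2r_t(x)$. Zooming dimension with multiplier $c>0$: the smallest $d\ge0$ such that for every $r\in(0,1]$ the set $X_{\mu,r}=\{x\in X: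 r/2<\Delta(x)\le r\}$ can be covered by $c\,r^{-d}$ sets of diameter strictly less than $r/8$.
   Formalization: The bound is stated for times t ≥ 2, since at t = 1 log t = 0 makes it 0 and it fails if the first arm is suboptimal; the absolute constant is chosen for spaces within fixed ambient types, and uniformity over all spaces follows by placing countably many instances in one type. *)

theory Defs
  imports "HOL-Probability.Probability"
begin

section \<open>Lipschitz bandit instances\<close>

locale lipschitz_mab = Metric_space X D
  for X :: "'a set" and D :: "'a \<Rightarrow> 'a \<Rightarrow> real" +
  fixes \<mu> :: "'a \<Rightarrow> real" and P :: "'a \<Rightarrow> real measure"
  assumes diam_le_1: "\<And>x y. x \<in> X \<Longrightarrow> y \<in> X \<Longrightarrow> D x y \<le> 1"
    and mu_range: "\<And>x. x \<in> X \<Longrightarrow> \<mu> x \<in> {0..1}"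
    and mu_lipschitz: "\<And>x y. x \<in> X \<Longrightarrow> y \<in> X \<Longrightarrow> \<bar>\<mu> x - \<mu> y\<bar> \<le> D x y"
    and reward_law: "\<And>x. x \<in> X \<Longrightarrow> P x \<in> space (prob_algebra borel)"
    and reward_range: "\<And>x. x \<in> X \<Longrightarrow> AE y in P x. y \<in> {0..1}"
    and reward_mean: "\<And>x. x \<in> X \<Longrightarrow> (\<integral>y. y \<partial>P x) = \<mu> x"

definition mu_star :: "'a set \<Rightarrow> ('a \<Rightarrow> real) \<Rightarrow> real" where
  "mu_star X \<mu> = (SUP x\<in>X. \<mu> x)"

definition gap :: "'a set \<Rightarrow> ('a \<Rightarrow> real) \<Rightarrow> 'a \<Rightarrow> real" where
  "gap X \<mu> x = mu_star X \<mu> - \<mu> x"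

section \<open>Zooming dimension\<close>

text \<open>The library's \<^const>\<open>diameter\<close>, for a metric given as a function. It is only applied to
  subsets of a space of diameter at most 1, so the supremum is over a bounded set.\<close>

definition mdiameter :: "('a \<Rightarrow> 'a \<Rightarrow> real) \<Rightarrow> 'a set \<Rightarrow> real" where
  "mdiameter D S = (if S = {} then 0 else SUP (x, y)\<in>S \<times> S. D x y)"

definition gap_layer :: "'a set \<Rightarrow> ('a \<Rightarrow> real) \<Rightarrow> real \<Rightarrow> 'a set" where
  "gap_layer X \<mu> r = {x \<in> X. r / 2 < gap X \<mu> x \<and> gap X \<mu> x \<le> r}"

definition zooming_cover ::
  "'a set \<Rightarrow> ('a \<Rightarrow> 'a \<Rightarrow> real) \<Rightarrow> ('a \<Rightarrow> real) \<Rightarrow> real \<Rightarrow> real \<Rightarrow> bool" where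
  "zooming_cover X D \<mu> c d \<longleftrightarrow>
     (\<forall>r\<in>{0<..1}. \<exists>\<C>. finite \<C> \<and> real (card \<C>) \<le> c * r powr (- d) \<and>
        (\<forall>S\<in>\<C>. S \<subseteq> X \<and> mdiameter D S < r / 8) \<and> gap_layer X \<mu> r \<subseteq> \<Union>\<C>)"

definition is_zooming_dimension ::
  "'a set \<Rightarrow> ('a \<Rightarrow> 'a \<Rightarrow> real) \<Rightarrow> ('a \<Rightarrow> real) \<Rightarrow> real \<Rightarrow> real \<Rightarrow> bool" where
  "is_zooming_dimension X D \<mu> c d \<longleftrightarrow>
     0 \<le> d \<and> zooming_cover X D \<mu> c d \<and> (\<forall>d'\<ge>0. zooming_cover X D \<mu> c d' \<longrightarrow> d \<le> d')"

section \<open>Interaction of an algorithm with an instance\<close>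

text \<open>Rounds are numbered from 1. The \<sigma>-algebra \<open>F t\<close> is the information available
  when the arm of round \<open>t\<close> is chosen: it contains all rewards of earlier rounds and possibly
  internal randomness of the algorithm. Conditionally on \<open>F t\<close>, the reward of round \<open>t\<close> is
  distributed according to the law of the arm played. No \<sigma>-algebra on \<open>X\<close> is fixed:
  measurability is only asked of the random reward law.\<close>

locale bandit_process = lipschitz_mab X D \<mu> P + prob_space M + filtration "space M" F
  for X :: "'a set" and D :: "'a \<Rightarrow> 'a \<Rightarrow> real" and \<mu> :: "'a \<Rightarrow> real" and P :: "'a \<Rightarrow> real measure"
    and M :: "'w measure" and F :: "nat \<Rightarrow> 'w measure" +
  fixes arm :: "nat \<Rightarrow> 'w \<Rightarrow> 'a" and rew :: "nat \<Rightarrow> 'w \<Rightarrow> real"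
  assumes subalg: "\<And>t. subalgebra M (F t)"
    and arm_in: "\<And>t \<omega>. 1 \<le> t \<Longrightarrow> \<omega> \<in> space M \<Longrightarrow> arm t \<omega> \<in> X"
    and law_measurable: "\<And>t. 1 \<le> t \<Longrightarrow> (\<lambda>\<omega>. P (arm t \<omega>)) \<in> F t \<rightarrow>\<^sub>M prob_algebra borel"
    and rew_measurable: "\<And>t. 1 \<le> t \<Longrightarrow> rew t \<in> borel_measurable (F (Suc t))"
    and rew_cond_law: "\<And>t B. 1 \<le> t \<Longrightarrow> B \<in> sets borel \<Longrightarrow>
      AE \<omega> in M. real_cond_exp M (F t) (\<lambda>\<omega>. indicator B (rew t \<omega>)) \<omega> = measure (P (arm t \<omega>)) B"

definition regret ::
  "'a set \<Rightarrow> ('a \<Rightarrow> real) \<Rightarrow> 'w measure \<Rightarrow> (nat \<Rightarrow> 'w \<Rightarrow> 'a) \<Rightarrow> nat \<Rightarrow> real" where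
  "regret X \<mu> M arm t =
     real t * mu_star X \<mu> - prob_space.expectation M (\<lambda>\<omega>. \<Sum>s=1..t. \<mu> (arm s \<omega>))"

section \<open>The zooming algorithm\<close>

definition phase_start :: "nat \<Rightarrow> nat" where
  "phase_start i = 1 + (\<Sum>j=1..<i. 2 ^ j)"

definition phase_rounds :: "nat \<Rightarrow> nat set" where
  "phase_rounds i = {phase_start i ..< phase_start i + 2 ^ i}"

text \<open>In the following, \<open>act\<close>, \<open>a\<close> and \<open>y\<close> form a single trajectory: \<open>act t\<close> is the arm
  activated in round \<open>t\<close> (if any), \<open>a t\<close> the arm played and \<open>y t\<close> the reward received.
  The index \<open>i\<close> is the phase containing round \<open>t\<close>.\<close>

definition plays :: "nat \<Rightarrow> (nat \<Rightarrow> 'a) \<Rightarrow> nat \<Rightarrow> 'a \<Rightarrow> nat set" where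
  "plays i a t x = {s \<in> phase_rounds i. s < t \<and> a s = x}"

definition n_plays :: "nat \<Rightarrow> (nat \<Rightarrow> 'a) \<Rightarrow> nat \<Rightarrow> 'a \<Rightarrow> nat" where
  "n_plays i a t x = card (plays i a t x)"

definition avg_reward :: "nat \<Rightarrow> (nat \<Rightarrow> 'a) \<Rightarrow> (nat \<Rightarrow> real) \<Rightarrow> nat \<Rightarrow> 'a \<Rightarrow> real" where
  "avg_reward i a y t x =
     (if n_plays i a t x = 0 then 0 else (\<Sum>s\<in>plays i a t x. y s) / real (n_plays i a t x))"

definition conf_radius :: "nat \<Rightarrow> (nat \<Rightarrow> 'a) \<Rightarrow> nat \<Rightarrow> 'a \<Rightarrow> real" where
  "conf_radius i a t x = sqrt (8 * real i / (1 + real (n_plays i a t x)))"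

definition arm_index :: "nat \<Rightarrow> (nat \<Rightarrow> 'a) \<Rightarrow> (nat \<Rightarrow> real) \<Rightarrow> nat \<Rightarrow> 'a \<Rightarrow> real" where
  "arm_index i a y t x = avg_reward i a y t x + 2 * conf_radius i a t x"

definition active_before :: "nat \<Rightarrow> (nat \<Rightarrow> 'a option) \<Rightarrow> nat \<Rightarrow> 'a set" where
  "active_before i act t = {x. \<exists>s\<in>phase_rounds i. s < t \<and> act s = Some x}"

definition active_after :: "nat \<Rightarrow> (nat \<Rightarrow> 'a option) \<Rightarrow> nat \<Rightarrow> 'a set" where
  "active_after i act t = {x. \<exists>s\<in>phase_rounds i. s \<le> t \<and> act s = Some x}"

definition uncovered ::
  "'a set \<Rightarrow> ('a \<Rightarrow> 'a \<Rightarrow> real) \<Rightarrow> nat \<Rightarrow> (nat \<Rightarrow> 'a option) \<Rightarrow> (nat \<Rightarrow> 'a) \<Rightarrow> nat \<Rightarrow> 'a set" where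
  "uncovered X D i act a t =
     X - (\<Union>z\<in>active_before i act t. Metric_space.mball X D z (conf_radius i a t z))"

definition activation_rule ::
  "'a set \<Rightarrow> ('a \<Rightarrow> 'a \<Rightarrow> real) \<Rightarrow> nat \<Rightarrow> (nat \<Rightarrow> 'a option) \<Rightarrow> (nat \<Rightarrow> 'a) \<Rightarrow> nat \<Rightarrow> bool" where
  "activation_rule X D i act a t \<longleftrightarrow>
     (if uncovered X D i act a t = {} then act t = None
      else \<exists>x\<in>uncovered X D i act a t. act t = Some x)"

definition selection_rule ::
  "nat \<Rightarrow> (nat \<Rightarrow> 'a option) \<Rightarrow> (nat \<Rightarrow> 'a) \<Rightarrow> (nat \<Rightarrow> real) \<Rightarrow> nat \<Rightarrow> bool" where
  "selection_rule i act a y t \<longleftrightarrow>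
     a t \<in> active_after i act t \<and>
     (\<forall>x\<in>active_after i act t. arm_index i a y t x \<le> arm_index i a y t (a t))"

definition zooming_trajectory ::
  "'a set \<Rightarrow> ('a \<Rightarrow> 'a \<Rightarrow> real) \<Rightarrow> (nat \<Rightarrow> 'a option) \<Rightarrow> (nat \<Rightarrow> 'a) \<Rightarrow> (nat \<Rightarrow> real) \<Rightarrow> bool" where
  "zooming_trajectory X D act a y \<longleftrightarrow>
     (\<forall>i\<ge>1. \<forall>t\<in>phase_rounds i. activation_rule X D i act a t \<and> selection_rule i act a y t)"

text \<open>Ties (which uncovered arm to activate, which maximiser to play) may be broken arbitrarily,
  depending on the past and on internal randomness. The last assumption says that the algorithm
  knows which activated arm it is playing; on a separable \<open>X\<close> it follows from Borel measurability
  of \<open>act\<close> and \<open>arm\<close>.\<close>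

locale zooming_run = bandit_process X D \<mu> P M F arm rew
  for X :: "'a set" and D :: "'a \<Rightarrow> 'a \<Rightarrow> real" and \<mu> :: "'a \<Rightarrow> real" and P :: "'a \<Rightarrow> real measure"
    and M :: "'w measure" and F :: "nat \<Rightarrow> 'w measure"
    and arm :: "nat \<Rightarrow> 'w \<Rightarrow> 'a" and rew :: "nat \<Rightarrow> 'w \<Rightarrow> real" +
  fixes act :: "nat \<Rightarrow> 'w \<Rightarrow> 'a option"
  assumes trajectory: "\<And>\<omega>. \<omega> \<in> space M \<Longrightarrow>
      zooming_trajectory X D (\<lambda>t. act t \<omega>) (\<lambda>t. arm t \<omega>) (\<lambda>t. rew t \<omega>)"
    and act_arm_measurable: "\<And>s t. 1 \<le> s \<Longrightarrow> s \<le> t \<Longrightarrow>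
      {\<omega> \<in> space M. act s \<omega> = Some (arm t \<omega>)} \<in> sets (F t)"

end

theory Submission
  imports Defs
begin

text \<open>
  In a phase \<open>i\<close> all of whose empirical means are within their confidence radii, the arm \<open>x\<close> played
  in round \<open>t\<close> has \<open>\<Delta>(x) \<le> 3 r\<^sub>t(x)\<close>; hence \<open>x\<close> is played \<open>O(i) \<Delta>(x)\<^sup>-\<^sup>2\<close> times, and active arms with gaps in
  \<open>(r/2, r]\<close> are more than \<open>r/8\<close> apart, so that there are at most \<open>c r powr (-d)\<close> of them. Such gaps
  therefore occur in at most \<open>O(c i) r powr (-(d + 2))\<close> rounds of the phase.

  In the claimed bound the constant sits inside the power \<open>1/(d + 2)\<close>, so a factor that does not tend
  to 1 as \<open>d\<close> grows cannot be afforded. For this reason not the gaps are summed, but their powers with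
  exponent \<open>q = (d + 2)/2\<close>. A phase contributes \<open>O(sqrt (c i 2^i))\<close> to this sum: rounds with gap below
  \<open>\<delta> = (c i / 2^i) powr (1/(d + 2))\<close> contribute at most \<open>2^i \<delta> powr q\<close>, and the layers above \<open>\<delta>\<close> form a
  geometric series. Phases failing the confidence bounds are harmless since they have probability
  at most \<open>2^(-i)\<close> and every gap satisfies \<open>\<Delta> powr (d + 2) \<le> c\<close> (a nonempty layer needs at least one
  set to cover it). The phases again sum up geometrically to \<open>O(sqrt (c t ln t))\<close>, and Jensen's
  inequality for \<open>x powr q\<close>, in the form of a tangent line bound, gives the regret.
\<close>

section \<open>Real inequalities and phases\<close>

text \<open>The constant 2 is uniform in the ratio \<open>b\<close>. This matters because the ratio
  used later, \<open>2 powr q\<close>, grows with the dimension.\<close>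

lemma sum_powers_le:
  fixes b :: real
  assumes "2 \<le> b"
  shows "(\<Sum>j<Suc n. b ^ j) \<le> 2 * b ^ n"
proof (induction n)
  case (Suc n)
  have "(\<Sum>j<Suc (Suc n). b ^ j) \<le> 2 * b ^ n + b ^ Suc n"
    using Suc by simp
  also have "2 * b ^ n \<le> b * b ^ n"
    using assms by (intro mult_right_mono) auto
  finally show ?case by simp
qed simp

lemma sum_sqrt_two_powers_le: "(\<Sum>i=1..n. sqrt 2 ^ i) \<le> 4 * sqrt 2 ^ n"
proof (induction n)
  case (Suc n)
  \<comment> \<open>The induction step amounts to 4 + sqrt 2 <= 4 sqrt 2, that is, sqrt 2 >=
    4/3.\<close>
  have "4 / 3 \<le> sqrt (2::real)"
    by (rule real_le_rsqrt) (simp add: power2_eq_square)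
  then have "4 * sqrt 2 ^ n \<le> (3 * sqrt 2) * sqrt 2 ^ n"
    by (intro mult_right_mono) auto
  moreover have "(\<Sum>i=1..Suc n. sqrt 2 ^ i) = (\<Sum>i=1..n. sqrt 2 ^ i) + sqrt 2 * sqrt (2::real) ^ n"
    by simp
  ultimately show ?case using Suc unfolding power_Suc by linarith
qed simp

text \<open>The tangent of \<open>x powr q\<close> at 1 lies below the function:
  \<open>x powr q\<close> = x exp((q - 1) ln x) >= x + (q - 1) x ln x, and x ln x >= x - 1. It
  serves as a pointwise form of Jensen's inequality.\<close>

lemma bernoulli_powr:
  fixes x q :: real
  assumes "0 \<le> x" "1 \<le> q"
  shows "q * x \<le> q - 1 + x powr q"
proof (cases "x = 0")
  case False
  then have x: "0 < x" using assms by simp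
  have "ln (1 / x) \<le> 1 / x - 1"
    using x by (intro ln_le_minus_one) simp
  then have "x * (1 - 1 / x) \<le> x * ln x"
    using x by (intro mult_left_mono) (auto simp: ln_div)
  then have "(q - 1) * (x - 1) \<le> (q - 1) * (x * ln x)"
    using x assms by (intro mult_left_mono) (auto simp: right_diff_distrib)
  moreover have "x * (1 + (q - 1) * ln x) \<le> x * x powr (q - 1)"
    using x exp_ge_add_one_self[of "(q - 1) * ln x"] by (intro mult_left_mono) (auto simp: powr_def)
  moreover have "x * x powr (q - 1) = x powr q"
    using x by (simp add: powr_mult_base)
  ultimately show ?thesis by (simp add: algebra_simps)
qed (use assms in auto)

section \<open>Phases as dyadic blocks of rounds\<close>

lemma finite_phase_rounds [simp]: "finite (phase_rounds i)"
  by (simp add: phase_rounds_def)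

lemma card_phase_rounds [simp]: "card (phase_rounds i) = 2 ^ i"
  by (simp add: phase_rounds_def)

lemma phase_rounds_ge_1: "s \<in> phase_rounds i \<Longrightarrow> 1 \<le> s"
  by (simp add: phase_rounds_def phase_start_def)

lemma phase_start_Suc: "1 \<le> i \<Longrightarrow> phase_start (Suc i) = phase_start i + 2 ^ i"
  by (simp add: phase_start_def)

text \<open>Written additively to avoid subtraction on naturals.\<close>

lemma phase_start_eq: "1 \<le> i \<Longrightarrow> phase_start i + 1 = 2 ^ i"
proof (induction i rule: dec_induct)
  case base
  show ?case by (simp add: phase_start_def)
next
  case (step i)
  then show ?case using phase_start_Suc[of i] by simp
qed

lemma sum_phases:
  "(\<Sum>s=1..<phase_start (Suc n). f s) = (\<Sum>i=1..n. \<Sum>s\<in>phase_rounds i. f s)"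
proof (induction n)
  case 0
  show ?case by (simp add: phase_start_def)
next
  case (Suc n)
  have "1 \<le> phase_start (Suc n)" by (simp add: phase_start_def)
  then show ?case
    using Suc phase_start_Suc[of "Suc n"]
      sum.atLeastLessThan_concat[of 1 "phase_start (Suc n)" "phase_start (Suc n) + 2 ^ Suc n" f]
    by (simp add: phase_rounds_def)
qed

section \<open>A phase with valid confidence radii\<close>

context lipschitz_mab
begin

lemma bdd_above_mu: "bdd_above (\<mu> ` X)"
  using mu_range by (intro bdd_aboveI[of _ 1]) auto

lemma gap_nonneg: "x \<in> X \<Longrightarrow> 0 \<le> gap X \<mu> x"
  using cSUP_upper[OF _ bdd_above_mu] by (simp add: gap_def mu_star_def)

lemma gap_le_1: "x \<in> X \<Longrightarrow> gap X \<mu> x \<le> 1"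
proof -
  assume x: "x \<in> X"
  then have "mu_star X \<mu> \<le> 1"
    unfolding mu_star_def using mu_range by (intro cSUP_least) auto
  with mu_range[OF x] show ?thesis
    by (simp add: gap_def)
qed

text \<open>The supremum \<open>mu_star\<close> need not be attained, so a slack \<open>e\<close> is
  carried along and removed at the end by letting it tend to 0.\<close>

lemma near_optimal_arm:
  assumes "x \<in> X" "0 < e"
  obtains z where "z \<in> X" "mu_star X \<mu> < \<mu> z + e"
proof -
  have "mu_star X \<mu> - e < (SUP x\<in>X. \<mu> x)"
    using assms by (simp add: mu_star_def)
  then obtain z where "z \<in> X" "mu_star X \<mu> - e < \<mu> z"
    using assms(1) by (subst (asm) less_cSUP_iff[OF _ bdd_above_mu]) auto
  then show ?thesis
    using that[of z] by simp
qed

lemma dist_le_mdiameter: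
  assumes "S \<subseteq> X" "x \<in> S" "y \<in> S"
  shows "D x y \<le> mdiameter D S"
proof -
  have "bdd_above ((\<lambda>(x, y). D x y) ` (S \<times> S))"
    using diam_le_1 assms(1) by (intro bdd_aboveI[of _ 1]) auto
  from cSUP_upper[OF _ this, of "(x, y)"] show ?thesis
    using assms by (auto simp: mdiameter_def)
qed

text \<open>With r the gap of \<open>x\<close> itself, \<open>x\<close> lies in the layer of r, so
  the cover has at least one set and 1 <= c \<open>r powr (- d)\<close>. The bound involves
  \<open>c\<close> and so remains useful when \<open>c\<close> is small, unlike the trivial bound 1
  on gaps.\<close>

lemma gap_powr_le_multiplier:
  assumes cover: "zooming_cover X D \<mu> c d" and d: "0 \<le> d" and c: "0 < c" and x: "x \<in> X"
  shows "gap X \<mu> x powr (d + 2) \<le> c"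
proof (cases "gap X \<mu> x = 0")
  case True
  then show ?thesis using c by simp
next
  case False
  define r where "r = gap X \<mu> x"
  have r: "0 < r" "r \<le> 1"
    using False gap_nonneg[OF x] gap_le_1[OF x] by (auto simp: r_def)
  obtain \<C> where \<C>: "finite \<C>" "real (card \<C>) \<le> c * r powr (- d)" "gap_layer X \<mu> r \<subseteq> \<Union>\<C>"
    using cover r unfolding zooming_cover_def by (meson greaterThanAtMost_iff)
  have "x \<in> gap_layer X \<mu> r"
    using x r by (simp add: gap_layer_def r_def)
  then have "\<C> \<noteq> {}" using \<C>(3) by auto
  then have "1 \<le> real (card \<C>)"
    using \<C>(1) by (simp add: Suc_le_eq card_gt_0_iff)
  then have "1 \<le> c * r powr (- d)" using \<C>(2) by linarith
  then have "r powr d \<le> c"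
    using r by (simp add: powr_minus field_simps)
  moreover have "r powr (d + 2) \<le> r powr d"
    using r by (intro powr_mono') auto
  ultimately show ?thesis by (simp add: r_def)
qed

end

section \<open>Deterministic analysis of one phase along a fixed trajectory\<close>

locale zooming_phase = lipschitz_mab X D \<mu> P
  for X :: "'a set" and D :: "'a \<Rightarrow> 'a \<Rightarrow> real" and \<mu> :: "'a \<Rightarrow> real" and P :: "'a \<Rightarrow> real measure" +
  fixes i :: nat and act :: "nat \<Rightarrow> 'a option" and a :: "nat \<Rightarrow> 'a" and y :: "nat \<Rightarrow> real"
  assumes phase_ge_1: "1 \<le> i"
    and activation: "\<And>t. t \<in> phase_rounds i \<Longrightarrow> activation_rule X D i act a t"
    and selection: "\<And>t. t \<in> phase_rounds i \<Longrightarrow> selection_rule i act a y t"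
begin

lemma finite_plays [simp]: "finite (plays i a t x)"
  by (simp add: plays_def)

lemma conf_radius_pos: "0 < conf_radius i a t x"
  using phase_ge_1 by (simp add: conf_radius_def add_pos_nonneg)

lemma activated_uncovered:
  assumes "s \<in> phase_rounds i" "act s = Some x"
  shows "x \<in> uncovered X D i act a s"
  using activation[OF assms(1)] assms(2) by (auto simp: activation_rule_def split: if_splits)

lemma activated_in_space:
  "s \<in> phase_rounds i \<Longrightarrow> act s = Some x \<Longrightarrow> x \<in> X"
  using activated_uncovered by (auto simp: uncovered_def)

text \<open>The later arm \<open>z\<close> was uncovered when activated, hence outside the ball of
  \<open>x\<close>. The radius is the one of the earlier arm at the later time.\<close>

lemma activated_far_from_active:
  assumes "s \<in> phase_rounds i" "act s = Some x" "t \<in> phase_rounds i" "act t = Some z" "s < t"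
  shows "conf_radius i a t x \<le> D x z"
proof -
  have "x \<in> active_before i act t"
    using assms by (auto simp: active_before_def)
  then have "z \<notin> mball x (conf_radius i a t x)"
    using activated_uncovered[OF assms(3,4)] by (auto simp: uncovered_def)
  then show ?thesis
    using activated_in_space assms by auto
qed

text \<open>No arm is activated twice in a phase, since an active arm lies in its own ball of
  positive radius. So all plays of an arm in the phase come from its single activation round
  onwards.\<close>

lemma activated_before_played:
  assumes "s \<in> phase_rounds i" "act s = Some x" "u \<in> phase_rounds i" "a u = x"
  shows "s \<le> u"
proof (rule ccontr)
  assume "\<not> s \<le> u"
  obtain s' where s': "s' \<in> phase_rounds i" "s' \<le> u" "act s' = Some x"
    using selection[OF assms(3)] assms(4) by (auto simp: selection_rule_def active_after_def)
  then have "conf_radius i a s x \<le> D x x"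
    using activated_far_from_active[of s' x s x] assms \<open>\<not> s \<le> u\<close> by auto
  with conf_radius_pos[of s x] activated_in_space[OF assms(1,2)] show False
    by simp
qed

lemma played_in_space: "t \<in> phase_rounds i \<Longrightarrow> a t \<in> X"
  using selection[of t] activated_in_space by (auto simp: selection_rule_def active_after_def)

text \<open>One activation per round suffices to cover everything: a freshly activated arm has no
  plays, so its radius \<open>sqrt (8 * real i)\<close> exceeds 1, the bound on the
  diameter.\<close>

lemma covered_after_activation:
  assumes t: "t \<in> phase_rounds i" and x: "x \<in> X"
  obtains z where "z \<in> active_after i act t" "z \<in> X" "D z x < conf_radius i a t z"
proof (cases "uncovered X D i act a t = {}")
  case True
  then obtain z where z: "z \<in> active_before i act t" "x \<in> mball z (conf_radius i a t z)"
    using x by (auto simp: uncovered_def)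
  then show ?thesis
    by (intro that[of z]) (auto simp: active_before_def active_after_def intro: less_imp_le)
next
  case False
  then obtain z where z: "act t = Some z" "z \<in> X"
    using activation[OF t] by (auto simp: activation_rule_def uncovered_def)
  have "plays i a t z = {}"
    using activated_before_played[OF t z(1)] by (force simp: plays_def)
  then have "conf_radius i a t z = sqrt (8 * real i)"
    by (simp add: conf_radius_def n_plays_def)
  moreover have "1 < sqrt (8 * real i)"
    using phase_ge_1 by simp
  ultimately have "D z x < conf_radius i a t z"
    using diam_le_1[OF z(2) x] by linarith
  moreover have "z \<in> active_after i act t"
    using t z(1) by (auto simp: active_after_def)
  ultimately show ?thesis
    using that[of z] z(2) by blast
qed

lemma n_plays_after_last_play:
  assumes "u \<in> phase_rounds i" "\<And>v. v \<in> plays i a t x \<Longrightarrow> v \<le> u" "u < t" "a u = x"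
  shows "n_plays i a t x = Suc (n_plays i a u x)"
proof -
  have "plays i a t x = insert u (plays i a u x)"
    using assms by (force simp: plays_def)
  moreover have "u \<notin> plays i a u x"
    by (simp add: plays_def)
  ultimately show ?thesis
    by (simp add: n_plays_def)
qed

text \<open>Only arms activated so far are constrained. They can be indexed by rounds, which makes a
  union bound over finitely many events possible even on an infinite \<open>X\<close>.\<close>

definition clean :: bool where
  "clean \<longleftrightarrow> (\<forall>t\<in>phase_rounds i. \<forall>x\<in>active_after i act t.
     \<bar>avg_reward i a y t x - \<mu> x\<bar> \<le> conf_radius i a t x)"

text \<open>Let \<open>z\<close> be an active arm whose ball contains a nearly optimal arm.
  Lipschitz continuity and one radius for the empirical mean put the index of \<open>z\<close> above
  \<open>mu_star\<close> up to \<open>e\<close>. The index of the played arm is at least as large,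
  and exceeds its mean by at most three radii.\<close>

lemma gap_played_le:
  assumes clean and t: "t \<in> phase_rounds i"
  shows "gap X \<mu> (a t) \<le> 3 * conf_radius i a t (a t)"
proof (rule field_le_epsilon)
  fix e :: real assume "0 < e"
  have at: "a t \<in> active_after i act t"
    and best: "\<And>x. x \<in> active_after i act t \<Longrightarrow> arm_index i a y t x \<le> arm_index i a y t (a t)"
    using selection[OF t] by (auto simp: selection_rule_def)
  obtain o' where o': "o' \<in> X" "mu_star X \<mu> < \<mu> o' + e"
    using near_optimal_arm[OF played_in_space[OF t] \<open>0 < e\<close>] .
  obtain z where z: "z \<in> active_after i act t" "z \<in> X" "D z o' < conf_radius i a t z"
    using covered_after_activation[OF t o'(1)] .
  have "\<bar>avg_reward i a y t z - \<mu> z\<bar> \<le> conf_radius i a t z"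
       "\<bar>avg_reward i a y t (a t) - \<mu> (a t)\<bar> \<le> conf_radius i a t (a t)"
    using \<open>clean\<close> t z(1) at by (auto simp: clean_def)
  moreover have "\<bar>\<mu> z - \<mu> o'\<bar> \<le> D z o'"
    using mu_lipschitz z o' by blast
  ultimately show "gap X \<mu> (a t) \<le> 3 * conf_radius i a t (a t) + e"
    using best[OF z(1)] o'(2) z(3) unfolding arm_index_def gap_def by linarith
qed

lemma gap_le_four_conf_radius:
  assumes clean and t: "t \<in> phase_rounds i" and z: "z \<in> X"
  shows "gap X \<mu> z \<le> 4 * conf_radius i a t z"
\<comment> \<open>Since the last play of \<open>z\<close> the radius has shrunk by the factor \<open>sqrt (n / (n + 1))\<close>, which is
  at least 3/4 only for \<open>n \<ge> 2\<close>; for \<open>n \<le> 1\<close> the radius exceeds the diameter anyway.\<close>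
proof (cases "n_plays i a t z \<le> 1")
  case True
  have "1 \<le> 8 * real i / (1 + real (n_plays i a t z))"
    using True phase_ge_1 by (simp add: field_simps)
  then have "1 \<le> conf_radius i a t z"
    unfolding conf_radius_def by simp
  then show ?thesis
    using gap_le_1[OF z] by linarith
next
  case False
  define n where "n = n_plays i a t z"
  define s where "s = Max (plays i a t z)"
  have "plays i a t z \<noteq> {}"
    using False by (auto simp: n_plays_def)
  then have "s \<in> plays i a t z"
    unfolding s_def by (intro Max_in) auto
  then have s: "s \<in> phase_rounds i" "s < t" "a s = z"
    by (auto simp: plays_def)
  have n: "n = Suc (n_plays i a s z)"
    unfolding n_def using s by (intro n_plays_after_last_play) (auto simp: s_def)
  have "gap X \<mu> z \<le> 3 * sqrt (8 * real i / real n)"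
    using gap_played_le[OF \<open>clean\<close> s(1)] s n by (simp add: conf_radius_def)
  also have "\<dots> = sqrt (9 * (8 * real i / real n))"
    by (simp only: real_sqrt_mult) simp
  also have "\<dots> \<le> sqrt (16 * (8 * real i / (1 + real n)))"
    using False n_def by (intro real_sqrt_le_mono) (simp add: field_simps mult_left_mono)
  also have "\<dots> = 4 * conf_radius i a t z"
    by (simp only: real_sqrt_mult conf_radius_def n_def) simp
  finally show ?thesis .
qed

text \<open>At the last play of \<open>x\<close> the quantity 1 + n in the radius is exactly the
  total number of plays in the phase. Squaring the gap bound there gives 72 = 9 * 8.\<close>

lemma card_plays_mult_gap_le:
  assumes clean
  shows "real (card {s \<in> phase_rounds i. a s = x}) * (gap X \<mu> x)\<^sup>2 \<le> 72 * real i"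
proof (cases "{s \<in> phase_rounds i. a s = x} = {}")
  case False
  define A where "A = {s \<in> phase_rounds i. a s = x}"
  define u where "u = Max A"
  have "u \<in> A"
    unfolding u_def using False by (intro Max_in) (auto simp: A_def)
  then have u: "u \<in> phase_rounds i" "a u = x"
    by (auto simp: A_def)
  have "A = insert u (plays i a u x)"
    using u Max_ge[of A] unfolding u_def[symmetric] by (force simp: plays_def A_def)
  moreover have "u \<notin> plays i a u x"
    by (simp add: plays_def)
  ultimately have card: "card A = Suc (n_plays i a u x)"
    by (simp add: n_plays_def)
  have "(gap X \<mu> x)\<^sup>2 \<le> (3 * conf_radius i a u x)\<^sup>2"
    using gap_played_le[OF \<open>clean\<close> u(1)] gap_nonneg[OF played_in_space[OF u(1)]] u
    by (intro power_mono) auto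
  also have "\<dots> = 72 * real i / real (card A)"
    by (simp add: power_mult_distrib conf_radius_def card)
  finally show ?thesis
    unfolding A_def[symmetric] using card by (simp add: field_simps)
qed (simp del: Collect_empty_eq)

text \<open>A packing argument: played arms of the layer are more than \<open>r / 8\<close> apart,
  so a covering set of diameter below \<open>r / 8\<close> contains at most one of them.\<close>

lemma active_arms_in_layer:
  assumes clean and \<C>: "finite \<C>" "\<And>S. S \<in> \<C> \<Longrightarrow> S \<subseteq> X \<and> mdiameter D S < r / 8"
      "gap_layer X \<mu> r \<subseteq> \<Union>\<C>"
    and A: "A \<subseteq> gap_layer X \<mu> r" "A \<subseteq> a ` phase_rounds i"
  shows "card A \<le> card \<C>"
proof -
  have activated: "\<exists>s\<in>phase_rounds i. act s = Some x" if "x \<in> A" for x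
    using that A(2) selection by (force simp: selection_rule_def active_after_def)
  \<comment> \<open>Only the gap of the earlier activated arm \<open>x\<close> enters:
    \<open>r / 2\<close> is below its gap, which is at most 4 of its radii, and \<open>z\<close>
    lies outside its ball.\<close>
  have far: "r / 8 < D x z"
    if "s \<in> phase_rounds i" "act s = Some x" "t \<in> phase_rounds i" "act t = Some z" "s < t" "x \<in> A"
    for x z s t
  proof -
    have "gap X \<mu> x \<le> 4 * conf_radius i a t x"
      using gap_le_four_conf_radius[OF \<open>clean\<close>] that activated_in_space by blast
    moreover have "conf_radius i a t x \<le> D x z"
      using activated_far_from_active that by blast
    moreover have "r / 2 < gap X \<mu> x"
      using A(1) that(6) by (auto simp: gap_layer_def)
    ultimately show ?thesis by linarith
  qed
  have sep: "r / 8 < D x z" if xz: "x \<in> A" "z \<in> A" "x \<noteq> z" for x z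
  proof -
    obtain s t where st: "s \<in> phase_rounds i" "act s = Some x" "t \<in> phase_rounds i" "act t = Some z"
      using activated xz by blast
    then have "s < t \<or> t < s"
      using xz(3) by (cases s t rule: linorder_cases) auto
    then show ?thesis
      using far[of s x t z] far[of t z s x] st xz commute by auto
  qed
  have "\<forall>x\<in>A. \<exists>S\<in>\<C>. x \<in> S"
    using A(1) \<C>(3) by auto
  then obtain f where f: "\<And>x. x \<in> A \<Longrightarrow> f x \<in> \<C> \<and> x \<in> f x"
    by metis
  have "inj_on f A"
  proof (rule inj_onI, rule ccontr)
    fix x z assume xz: "x \<in> A" "z \<in> A" "f x = f z" "x \<noteq> z"
    then have "D x z \<le> mdiameter D (f x)"
      using f \<C>(2) by (intro dist_le_mdiameter) auto
    with \<C>(2)[of "f x"] f[of x] sep[of x z] xz show False by auto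
  qed
  then show ?thesis
    using f \<C>(1) by (intro card_inj_on_le[of f]) auto
qed

text \<open>At most c \<open>r powr (- d)\<close> arms of the layer are played, each at most 72 i /
  (r/2)^2 = 288 i / r^2 times.\<close>

lemma card_plays_in_layer_le:
  assumes clean and cover: "zooming_cover X D \<mu> c d" and r: "0 < r" "r \<le> 1"
  shows "real (card {s \<in> phase_rounds i. a s \<in> gap_layer X \<mu> r}) \<le> 288 * real i * c * r powr (- (d + 2))"
proof -
  obtain \<C> where \<C>: "finite \<C>" "real (card \<C>) \<le> c * r powr (- d)"
      "\<And>S. S \<in> \<C> \<Longrightarrow> S \<subseteq> X \<and> mdiameter D S < r / 8" "gap_layer X \<mu> r \<subseteq> \<Union>\<C>"
    using cover r unfolding zooming_cover_def by (meson greaterThanAtMost_iff)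
  define A where "A = a ` phase_rounds i \<inter> gap_layer X \<mu> r"
  have "finite A" by (simp add: A_def)
  have "card A \<le> card \<C>"
    using active_arms_in_layer[OF \<open>clean\<close> \<C>(1,3,4)] by (simp add: A_def)
  then have cardA: "real (card A) \<le> c * r powr (- d)"
    using \<C>(2) by linarith
  have each: "real (card {s \<in> phase_rounds i. a s = x}) \<le> 288 * real i / r\<^sup>2" if "x \<in> A" for x
  proof -
    have "(r / 2)\<^sup>2 \<le> (gap X \<mu> x)\<^sup>2"
      using that r by (intro power_mono) (auto simp: A_def gap_layer_def)
    then have "real (card {s \<in> phase_rounds i. a s = x}) * (r / 2)\<^sup>2
        \<le> real (card {s \<in> phase_rounds i. a s = x}) * (gap X \<mu> x)\<^sup>2"
      by (intro mult_left_mono) auto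
    also have "\<dots> \<le> 72 * real i"
      by (rule card_plays_mult_gap_le[OF \<open>clean\<close>])
    finally show ?thesis
      using r by (simp add: field_simps power2_eq_square)
  qed
  have "{s \<in> phase_rounds i. a s \<in> gap_layer X \<mu> r} = (\<Union>x\<in>A. {s \<in> phase_rounds i. a s = x})"
    by (auto simp: A_def)
  then have "real (card {s \<in> phase_rounds i. a s \<in> gap_layer X \<mu> r})
      \<le> (\<Sum>x\<in>A. real (card {s \<in> phase_rounds i. a s = x}))"
    using card_UN_le[OF \<open>finite A\<close>, of "\<lambda>x. {s \<in> phase_rounds i. a s = x}"]
    by (simp flip: of_nat_sum)
  also have "\<dots> \<le> real (card A) * (288 * real i / r\<^sup>2)"
    using each by (rule sum_bounded_above)
  also have "\<dots> \<le> (c * r powr (- d)) * (288 * real i / r\<^sup>2)"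
    using cardA by (intro mult_right_mono) auto
  also have "\<dots> = 288 * real i * c * r powr (- (d + 2))"
    using r powr_add[of r "- d" "- 2"] by (simp add: powr_minus field_simps)
  finally show ?thesis .
qed


lemma sum_gap_powr_clean:
  assumes clean and cover: "zooming_cover X D \<mu> c d" and d: "0 \<le> d" and c: "0 < c"
  shows "(\<Sum>s\<in>phase_rounds i. gap X \<mu> (a s) powr ((d + 2) / 2)) \<le> 577 * sqrt (c * real i * 2 ^ i)"
proof -
  define q where "q = (d + 2) / 2"
  define w where "w = sqrt (c * real i / 2 ^ i)"
  \<comment> \<open>The threshold at which the two bounds balance: rounds with gap at most
    \<open>\<delta>\<close> cost \<open>w\<close> each, and 2^i \<open>w\<close> and c i /
    \<open>w\<close> are both \<open>sqrt (c * real i * 2 ^ i)\<close>.\<close>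
  define \<delta> where "\<delta> = w powr (1 / q)"
  \<comment> \<open>Ratio of the geometric series: layer \<open>j\<close> has O(c i)
    \<open>\<rho> j powr (- 2 q)\<close> plays of cost at most \<open>\<rho> j powr q\<close> each,
    and the product of the two powers is \<open>b ^ j\<close>.\<close>
  define b where "b = (2::real) powr q"
  define \<rho> where "\<rho> j = (1 / 2 :: real) ^ j" for j :: nat
  define L where "L j = {s \<in> phase_rounds i. a s \<in> gap_layer X \<mu> (\<rho> j)}" for j
  have q: "1 \<le> q" using d by (simp add: q_def)
  have w: "0 < w" using c phase_ge_1 by (simp add: w_def)
  have \<delta>: "0 < \<delta>" "\<delta> powr q = w"
    using w q by (auto simp: \<delta>_def powr_powr)
  have b: "2 \<le> b"
    using powr_mono[of 1 q 2] q by (simp add: b_def)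
  have \<rho>: "0 < \<rho> j" "\<rho> j \<le> 1" "\<rho> j powr (- q) = b ^ j" "\<rho> (Suc j) = \<rho> j / 2" for j
  proof -
    have "\<rho> j = 2 powr (- real j)"
      by (simp add: \<rho>_def powr_minus powr_realpow power_one_over inverse_eq_divide)
    then show "\<rho> j powr (- q) = b ^ j"
      by (simp add: b_def powr_powr powr_power mult.commute)
  qed (auto simp: \<rho>_def power_le_one)
  have "\<exists>j. \<rho> j \<le> \<delta>"
    using real_arch_pow_inv[of \<delta> "1 / 2"] \<delta>(1) by (auto simp: \<rho>_def intro: less_imp_le)
  define N where "N = (LEAST j. \<rho> j \<le> \<delta>)"
  have N: "\<rho> N \<le> \<delta>"
    unfolding N_def by (rule LeastI_ex) fact
  have N_min: "\<delta> < \<rho> j" if "j < N" for j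
    using not_less_Least[OF that[unfolded N_def]] by simp
  have gap: "0 \<le> gap X \<mu> (a s)" "gap X \<mu> (a s) \<le> 1" if "s \<in> phase_rounds i" for s
    using gap_nonneg gap_le_1 played_in_space that by auto
  have layers: "\<exists>j<N. s \<in> L j" if s: "s \<in> phase_rounds i" "\<delta> < gap X \<mu> (a s)" for s
  proof -
    \<comment> \<open>Minimality gives the upper bound \<open>\<rho> j\<close> on the gap; for
      \<open>j\<close> = 0 it is the bound 1 on all gaps.\<close>
    define j where "j = (LEAST j. \<rho> (Suc j) < gap X \<mu> (a s))"
    have "\<exists>j. \<rho> (Suc j) < gap X \<mu> (a s)"
      using \<rho>(1,4)[of N] N s(2) by (intro exI[of _ N]) linarith
    then have j: "\<rho> (Suc j) < gap X \<mu> (a s)"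
      unfolding j_def by (rule LeastI_ex)
    have j_min: "gap X \<mu> (a s) \<le> \<rho> (Suc k)" if "k < j" for k
      using not_less_Least[OF that[unfolded j_def]] by simp
    have le: "gap X \<mu> (a s) \<le> \<rho> j"
      using gap(2)[OF s(1)] j_min by (cases j) (auto simp: \<rho>_def)
    have "j < N"
    proof (rule ccontr)
      assume "\<not> j < N"
      then have "\<rho> j \<le> \<rho> N"
        unfolding \<rho>_def by (intro power_decreasing) auto
      with le N s(2) show False by linarith
    qed
    moreover have "s \<in> L j"
      using s le j played_in_space by (simp add: L_def gap_layer_def \<rho>(4))
    ultimately show ?thesis by blast
  qed
  have "(\<Sum>s\<in>phase_rounds i. gap X \<mu> (a s) powr q)
      \<le> (\<Sum>s\<in>phase_rounds i. w + (\<Sum>j<N. if s \<in> L j then \<rho> j powr q else 0))"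
  proof (rule sum_mono)
    fix s assume s: "s \<in> phase_rounds i"
    have nonneg: "0 \<le> (\<Sum>j<N. if s \<in> L j then \<rho> j powr q else 0)"
      by (intro sum_nonneg) auto
    show "gap X \<mu> (a s) powr q \<le> w + (\<Sum>j<N. if s \<in> L j then \<rho> j powr q else 0)"
    proof (cases "gap X \<mu> (a s) \<le> \<delta>")
      case True
      then have "gap X \<mu> (a s) powr q \<le> w"
        using gap[OF s] q unfolding \<delta>(2)[symmetric] by (intro powr_mono2) auto
      with nonneg show ?thesis by linarith
    next
      case False
      then obtain j where j: "j < N" "s \<in> L j"
        using layers[OF s] by auto
      have "gap X \<mu> (a s) powr q \<le> (if s \<in> L j then \<rho> j powr q else 0)"
        using j(2) gap[OF s] q by (auto simp: L_def gap_layer_def intro!: powr_mono2)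
      also have "\<dots> \<le> (\<Sum>j<N. if s \<in> L j then \<rho> j powr q else 0)"
        using j(1) by (intro member_le_sum) auto
      finally show ?thesis using w by linarith
    qed
  qed
  also have "\<dots> = 2 ^ i * w + (\<Sum>j<N. \<Sum>s\<in>phase_rounds i. if s \<in> L j then \<rho> j powr q else 0)"
    by (subst sum.distrib, subst sum.swap) (simp add: phase_rounds_def)
  also have "(\<Sum>j<N. \<Sum>s\<in>phase_rounds i. if s \<in> L j then \<rho> j powr q else 0)
      = (\<Sum>j<N. real (card (L j)) * \<rho> j powr q)"
  proof (rule sum.cong[OF refl])
    fix j
    have "L j = phase_rounds i \<inter> L j" by (auto simp: L_def)
    then show "(\<Sum>s\<in>phase_rounds i. if s \<in> L j then \<rho> j powr q else 0) = real (card (L j)) * \<rho> j powr q"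
      by (simp flip: sum.inter_restrict)
  qed
  also have "\<dots> \<le> (\<Sum>j<N. 288 * real i * c * b ^ j)"
  proof (rule sum_mono)
    fix j
    have "real (card (L j)) * \<rho> j powr q \<le> (288 * real i * c * \<rho> j powr (- (d + 2))) * \<rho> j powr q"
      unfolding L_def using \<rho>(1,2)[of j]
      by (intro mult_right_mono card_plays_in_layer_le[OF \<open>clean\<close> cover]) auto
    also have "\<dots> = 288 * real i * c * (\<rho> j powr (- (d + 2)) * \<rho> j powr q)"
      by simp
    also have "\<rho> j powr (- (d + 2)) * \<rho> j powr q = \<rho> j powr (- q)"
    proof -
      have "- (d + 2) + q = - q" by (simp add: q_def field_simps)
      then show ?thesis by (simp only: powr_add[symmetric])
    qed
    finally show "real (card (L j)) * \<rho> j powr q \<le> 288 * real i * c * b ^ j"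
      by (simp add: \<rho>(3))
  qed
  also have "\<dots> = 288 * real i * c * (\<Sum>j<N. b ^ j)"
    by (simp add: sum_distrib_left)
  also have "\<dots> \<le> 288 * real i * c * (2 / w)"
  proof (rule mult_left_mono)
    show "(\<Sum>j<N. b ^ j) \<le> 2 / w"
    proof (cases N)
      case 0
      then show ?thesis using w by simp
    next
      case (Suc m)
      have "(\<Sum>j<N. b ^ j) \<le> 2 * b ^ m"
        unfolding Suc by (rule sum_powers_le[OF b])
      \<comment> \<open>The last layer \<open>m\<close> = N - 1 still has scale above
        \<open>\<delta>\<close>, by minimality of \<open>N\<close>.\<close>
      also have "b ^ m \<le> \<delta> powr (- q)"
        unfolding \<rho>(3)[symmetric] using \<delta>(1) N_min[of m] Suc q by (intro powr_mono2') auto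
      also have "\<delta> powr (- q) = 1 / w"
        using \<delta> by (simp add: powr_minus_divide)
      finally show ?thesis by simp
    qed
  qed (use c in auto)
  \<comment> \<open>577 = 1 + 2 * 288, since both terms are multiples of
    \<open>2 ^ i * w\<close>.\<close>
  also have "2 ^ i * w + 288 * real i * c * (2 / w) = 577 * sqrt (c * real i * 2 ^ i)"
  proof -
    have sq: "w * w = c * real i / 2 ^ i"
      using c by (simp add: w_def)
    have "c * real i * 2 ^ i = (2 ^ i)\<^sup>2 * (c * real i / 2 ^ i)"
      by (simp add: power2_eq_square)
    then have e: "sqrt (c * real i * 2 ^ i) = 2 ^ i * w"
      by (simp only: real_sqrt_mult w_def) simp
    have "c * real i = 2 ^ i * (w * w)"
      unfolding sq by simp
    then have "288 * real i * c * (2 / w) = 576 * (2 ^ i * w)"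
      using w by (simp add: field_simps)
    then show ?thesis unfolding e by simp
  qed
  finally show ?thesis by (simp add: q_def)
qed

end

section \<open>Concentration of the empirical means\<close>

text \<open>Hoeffding's lemma for a range of length 1. Negative \<open>l\<close> is reduced to
  positive \<open>l\<close> by reflecting the reward to [-1, 0].\<close>

lemma (in lipschitz_mab) reward_exp_moment:
  assumes x: "x \<in> X"
  shows "(\<integral>\<^sup>+y. ennreal (exp (l * (y - \<mu> x))) \<partial>P x) \<le> ennreal (exp (l\<^sup>2 / 8))"
proof -
  have sets_P [measurable_cong]: "sets (P x) = sets borel" and "prob_space (P x)"
    using reward_law[OF x] by (auto simp: space_prob_algebra)
  interpret P: prob_space "P x" by fact
  consider "l = 0" | "0 < l" | "l < 0" by linarith
  then show ?thesis
  proof cases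
    case 1
    then show ?thesis using P.emeasure_space_1 by simp
  next
    case 2
    interpret interval_bounded_random_variable "P x" "\<lambda>y. y" 0 1
      using reward_range[OF x] by unfold_locales auto
    show ?thesis
      using Hoeffdings_lemma_nn_integral[OF 2] by (simp add: reward_mean[OF x])
  next
    case 3
    interpret interval_bounded_random_variable "P x" "\<lambda>y. - y" "- 1" 0
      using reward_range[OF x] by unfold_locales auto
    show ?thesis
      using Hoeffdings_lemma_nn_integral[of "- l"] 3 by (simp add: reward_mean[OF x] algebra_simps)
  qed
qed

section \<open>Conditional law of the rewards and an exponential supermartingale\<close>

context bandit_process
begin

lemma measurable_M: "f \<in> measurable (F t) N \<Longrightarrow> f \<in> measurable M N"
  using measurable_from_subalg[OF subalg] .

lemma rew_measurable_M: "1 \<le> t \<Longrightarrow> rew t \<in> borel_measurable M"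
  using rew_measurable measurable_M by blast

lemma law_measurable_subprob:
  "1 \<le> t \<Longrightarrow> (\<lambda>\<omega>. P (arm t \<omega>)) \<in> F t \<rightarrow>\<^sub>M subprob_algebra borel"
  using law_measurable by (rule measurable_prob_algebraD)

lemma measurable_F_mono: "s \<le> t \<Longrightarrow> f \<in> measurable (F s) N \<Longrightarrow> f \<in> measurable (F t) N"
  using sets_F_mono[of s t] space_F by (auto simp: measurable_def)

lemma mean_measurable: "1 \<le> t \<Longrightarrow> (\<lambda>\<omega>. \<mu> (arm t \<omega>)) \<in> borel_measurable (F t)"
proof -
  assume t: "1 \<le> t"
  have "(\<lambda>\<omega>. \<integral>y. y \<partial>P (arm t \<omega>)) \<in> borel_measurable (F t)"
    by (rule measurable_compose[OF law_measurable_subprob[OF t] integral_measurable_subprob_algebra]) simp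
  then show ?thesis
    using arm_in[OF t] reward_mean space_F by (subst measurable_cong) auto
qed

text \<open>Transfers the assumed conditional law from real to nonnegative conditional expectations.
  The negative part vanishes, and the value is at most 1 almost everywhere, so
  \<open>enn2real\<close> loses nothing.\<close>

lemma nn_cond_exp_reward_indicator:
  assumes t: "1 \<le> t" and B: "B \<in> sets borel"
  shows "AE \<omega> in M. nn_cond_exp M (F t) (\<lambda>\<omega>. indicator B (rew t \<omega>)) \<omega> = emeasure (P (arm t \<omega>)) B"
proof -
  interpret F: finite_measure_subalgebra M "F t"
    using subalg by unfold_locales
  note rew_measurable_M[OF t, measurable] B[measurable]
  have "AE \<omega> in M. nn_cond_exp M (F t) (\<lambda>\<omega>. indicator B (rew t \<omega>)) \<omega> \<le> nn_cond_exp M (F t) (\<lambda>_. 1) \<omega>"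
    by (rule F.nn_cond_exp_mono) (auto simp: indicator_def)
  moreover have "AE \<omega> in M. 1 = nn_cond_exp M (F t) (\<lambda>_. 1) \<omega>"
    by (rule F.nn_cond_exp_F_meas) simp
  moreover have "AE \<omega> in M. 0 = nn_cond_exp M (F t) (\<lambda>_. 0) \<omega>"
    by (rule F.nn_cond_exp_F_meas) simp
  moreover note rew_cond_law[OF t B] AE_space
  ultimately show ?thesis
  proof (eventually_elim, goal_cases)
    case (1 \<omega>)
    let ?n = "nn_cond_exp M (F t) (\<lambda>\<omega>. indicator B (rew t \<omega>)) \<omega>"
    have "ennreal (- indicator B (rew t \<omega>')) = 0" for \<omega>'
      by (simp add: ennreal_neg)
    moreover have "(\<lambda>\<omega>. ennreal (indicator B (rew t \<omega>))) = (\<lambda>\<omega>. indicator B (rew t \<omega>))"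
      by (auto simp: indicator_def)
    ultimately have "enn2real ?n = measure (P (arm t \<omega>)) B"
      using 1 by (simp add: real_cond_exp_def)
    moreover have "?n \<noteq> top"
      using 1 by (auto simp: top_unique)
    moreover have "emeasure (P (arm t \<omega>)) B = ennreal (measure (P (arm t \<omega>)) B)" if "\<omega> \<in> space M"
      using reward_law[OF arm_in[OF t that]]
      by (intro finite_measure.emeasure_eq_measure) (auto simp: space_prob_algebra prob_space_def)
    ultimately show ?case
      using 1(5) by (metis ennreal_enn2real less_top)
  qed
qed

text \<open>The reward can be integrated out against the law of the played arm, with any weight
  known before the reward. The proof is the standard induction over nonnegative Borel functions
  \<open>g\<close>; the conditional law enters only for indicators.\<close>

lemma nn_integral_reward:
  assumes t: "1 \<le> t" and W[measurable]: "W \<in> borel_measurable (F t)"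
    and g: "g \<in> borel_measurable borel"
  shows "(\<integral>\<^sup>+\<omega>. W \<omega> * g (rew t \<omega>) \<partial>M) = (\<integral>\<^sup>+\<omega>. W \<omega> * (\<integral>\<^sup>+y. g y \<partial>P (arm t \<omega>)) \<partial>M)"
proof -
  interpret F: finite_measure_subalgebra M "F t"
    using subalg by unfold_locales
  note rew_measurable_M[OF t, measurable] measurable_M[OF W, measurable]
  have K: "(\<lambda>\<omega>. P (arm t \<omega>)) \<in> M \<rightarrow>\<^sub>M subprob_algebra borel"
    using measurable_M[OF law_measurable_subprob[OF t]] .
  have sets_P: "sets (P (arm t \<omega>)) = sets borel" if "\<omega> \<in> space M" for \<omega>
    using reward_law[OF arm_in[OF t that]] by (auto simp: space_prob_algebra)
  have P_meas: "f \<in> borel_measurable (P (arm t \<omega>))" if "f \<in> borel_measurable borel" "\<omega> \<in> space M"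
    for \<omega> and f :: "real \<Rightarrow> ennreal"
    using that sets_P by (simp cong: measurable_cong_sets)
  have I_meas: "(\<lambda>\<omega>. \<integral>\<^sup>+y. f y \<partial>P (arm t \<omega>)) \<in> borel_measurable M"
    if "f \<in> borel_measurable borel" for f :: "real \<Rightarrow> ennreal"
    using measurable_compose[OF K nn_integral_measurable_subprob_algebra[OF that]] .
  have WI_meas: "(\<lambda>\<omega>. W \<omega> * (\<integral>\<^sup>+y. f y \<partial>P (arm t \<omega>))) \<in> borel_measurable M"
    if "f \<in> borel_measurable borel" for f :: "real \<Rightarrow> ennreal"
    by (rule borel_measurable_times_ennreal[OF measurable_M[OF W] I_meas[OF that]])
  show ?thesis using g
  proof induction
    case (cong f g)
    then have "f = g" by (intro ext) simp
    with cong.IH show ?case by simp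
  next
    case (set B)
    then have "(\<integral>\<^sup>+\<omega>. W \<omega> * indicator B (rew t \<omega>) \<partial>M)
        = (\<integral>\<^sup>+\<omega>. W \<omega> * nn_cond_exp M (F t) (\<lambda>\<omega>. indicator B (rew t \<omega>)) \<omega> \<partial>M)"
      by (intro F.nn_cond_exp_intg[symmetric] W measurable_compose[OF rew_measurable_M[OF t]]) simp
    also have "\<dots> = (\<integral>\<^sup>+\<omega>. W \<omega> * (\<integral>\<^sup>+y. indicator B y \<partial>P (arm t \<omega>)) \<partial>M)"
    proof (intro nn_integral_cong_AE)
      show "AE \<omega> in M. W \<omega> * nn_cond_exp M (F t) (\<lambda>\<omega>. indicator B (rew t \<omega>)) \<omega>
          = W \<omega> * (\<integral>\<^sup>+y. indicator B y \<partial>P (arm t \<omega>))"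
        using nn_cond_exp_reward_indicator[OF t set] AE_space
      proof eventually_elim
        case (elim \<omega>)
        then have "B \<in> sets (P (arm t \<omega>))"
          using set sets_P by simp
        with elim(1) show ?case by simp
      qed
    qed
    finally show ?case .
  next
    case (mult f c)
    note mult.hyps(2)[measurable]
    have "(\<integral>\<^sup>+\<omega>. W \<omega> * (c * f (rew t \<omega>)) \<partial>M) = c * (\<integral>\<^sup>+\<omega>. W \<omega> * f (rew t \<omega>) \<partial>M)"
      by (subst nn_integral_cmult[symmetric]) (auto simp: ac_simps)
    also have "\<dots> = (\<integral>\<^sup>+\<omega>. c * (W \<omega> * (\<integral>\<^sup>+y. f y \<partial>P (arm t \<omega>))) \<partial>M)"
      by (subst mult.IH, subst nn_integral_cmult[OF WI_meas]) (simp_all add: mult.hyps)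
    also have "\<dots> = (\<integral>\<^sup>+\<omega>. W \<omega> * (\<integral>\<^sup>+y. c * f y \<partial>P (arm t \<omega>)) \<partial>M)"
      by (intro nn_integral_cong) (simp add: nn_integral_cmult[OF P_meas[OF mult.hyps(2)]] ac_simps)
    finally show ?case .
  next
    case (add f g)
    note add.hyps(1,3)[measurable]
    have "(\<integral>\<^sup>+\<omega>. W \<omega> * (f (rew t \<omega>) + g (rew t \<omega>)) \<partial>M)
        = (\<integral>\<^sup>+\<omega>. W \<omega> * f (rew t \<omega>) \<partial>M) + (\<integral>\<^sup>+\<omega>. W \<omega> * g (rew t \<omega>) \<partial>M)"
      by (subst nn_integral_add[symmetric]) (auto simp: distrib_left)
    also have "\<dots> = (\<integral>\<^sup>+\<omega>. W \<omega> * (\<integral>\<^sup>+y. f y \<partial>P (arm t \<omega>)) + W \<omega> * (\<integral>\<^sup>+y. g y \<partial>P (arm t \<omega>)) \<partial>M)"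
      by (subst add.IH(1), subst add.IH(2), subst nn_integral_add[OF WI_meas WI_meas]) (simp_all add: add.hyps)
    also have "\<dots> = (\<integral>\<^sup>+\<omega>. W \<omega> * (\<integral>\<^sup>+y. f y + g y \<partial>P (arm t \<omega>)) \<partial>M)"
      by (intro nn_integral_cong)
        (simp add: nn_integral_add[OF P_meas[OF add.hyps(1)] P_meas[OF add.hyps(3)]] distrib_left)
    finally show ?case by (simp add: add.commute)
  next
    case (seq U)
    note seq.hyps(1)[measurable]
    have "(\<integral>\<^sup>+\<omega>. W \<omega> * (SUP n. U n) (rew t \<omega>) \<partial>M) = (\<integral>\<^sup>+\<omega>. (SUP n. W \<omega> * U n (rew t \<omega>)) \<partial>M)"
      by (simp add: SUP_mult_left_ennreal image_comp)
    also have "\<dots> = (SUP n. \<integral>\<^sup>+\<omega>. W \<omega> * U n (rew t \<omega>) \<partial>M)"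
    proof (intro nn_integral_monotone_convergence_SUP incseq_SucI le_funI mult_left_mono)
      show "U n (rew t \<omega>) \<le> U (Suc n) (rew t \<omega>)" for n \<omega>
        using le_funD[OF incseq_SucD[OF seq.hyps(3)]] .
    qed auto
    also have "\<dots> = (SUP n. \<integral>\<^sup>+\<omega>. W \<omega> * (\<integral>\<^sup>+y. U n y \<partial>P (arm t \<omega>)) \<partial>M)"
      by (simp add: seq.IH)
    also have "\<dots> = (\<integral>\<^sup>+\<omega>. (SUP n. W \<omega> * (\<integral>\<^sup>+y. U n y \<partial>P (arm t \<omega>))) \<partial>M)"
    proof (intro nn_integral_monotone_convergence_SUP[symmetric] incseq_SucI le_funI mult_left_mono
        nn_integral_mono WI_meas seq.hyps(1))
      show "U n y \<le> U (Suc n) y" for n y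
        using le_funD[OF incseq_SucD[OF seq.hyps(3)]] .
    qed auto
    also have "\<dots> = (\<integral>\<^sup>+\<omega>. W \<omega> * (\<integral>\<^sup>+y. (SUP n. U n) y \<partial>P (arm t \<omega>)) \<partial>M)"
    proof (rule nn_integral_cong)
      fix \<omega> assume "\<omega> \<in> space M"
      then have eq: "(\<integral>\<^sup>+y. (SUP n. U n) y \<partial>P (arm t \<omega>)) = (SUP n. \<integral>\<^sup>+y. U n y \<partial>P (arm t \<omega>))"
        using nn_integral_monotone_convergence_SUP[OF seq.hyps(3) P_meas[OF seq.hyps(1)]]
        by (simp add: image_comp)
      show "(SUP n. W \<omega> * (\<integral>\<^sup>+y. U n y \<partial>P (arm t \<omega>))) = W \<omega> * (\<integral>\<^sup>+y. (SUP n. U n) y \<partial>P (arm t \<omega>))"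
        unfolding eq by (simp only: SUP_mult_left_ennreal)
    qed
    finally show ?case .
  qed
qed

text \<open>Membership in \<open>A u\<close> is known before the reward of round \<open>u\<close>.
  Outside \<open>A u\<close> the new factor is 1; inside, its conditional expectation is at most 1
  by Hoeffding's lemma.\<close>

lemma exp_supermartingale:
  assumes s: "1 \<le> s" "s \<le> t" and A: "\<And>u. s \<le> u \<Longrightarrow> A u \<in> sets (F u)"
  shows "(\<integral>\<^sup>+\<omega>. ennreal (exp (\<Sum>u=s..<t. indicator (A u) \<omega> * (l * (rew u \<omega> - \<mu> (arm u \<omega>)) - l\<^sup>2 / 8))) \<partial>M) \<le> 1"
  using s(2)
proof (induction t rule: dec_induct)
  case base
  show ?case by (simp add: emeasure_space_1)
next
  case (step t)
  define Z where "Z t \<omega> = exp (\<Sum>u=s..<t. indicator (A u) \<omega> * (l * (rew u \<omega> - \<mu> (arm u \<omega>)) - l\<^sup>2 / 8))" for t \<omega>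
  have t: "1 \<le> t" using s step by simp
  have Z[measurable]: "Z t \<in> borel_measurable (F t)"
  proof -
    have "(\<lambda>\<omega>. indicator (A u) \<omega> * (l * (rew u \<omega> - \<mu> (arm u \<omega>)) - l\<^sup>2 / 8)) \<in> borel_measurable (F t)"
      if u: "u \<in> {s..<t}" for u
    proof -
      have [measurable]: "A u \<in> sets (F t)"
        using A[of u] sets_F_mono[of u t] u by auto
      have [measurable]: "rew u \<in> borel_measurable (F t)"
        using measurable_F_mono[OF _ rew_measurable[of u], of t] u s by auto
      have [measurable]: "(\<lambda>\<omega>. \<mu> (arm u \<omega>)) \<in> borel_measurable (F t)"
        using measurable_F_mono[OF _ mean_measurable[of u], of t] u s by auto
      show ?thesis by measurable
    qed
    then show ?thesis
      unfolding Z_def by (intro borel_measurable_exp[THEN measurable_compose_rev] borel_measurable_sum)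
  qed
  have Z_pos: "0 < Z t \<omega>" for \<omega> by (simp add: Z_def)
  have At[measurable]: "A t \<in> sets (F t)" using A step by simp
  note mean_measurable[OF t, measurable] rew_measurable_M[OF t, measurable]
  note [measurable] = measurable_M[OF Z] measurable_M[OF mean_measurable[OF t]]
  have [measurable]: "A t \<in> sets M" using At subalg[of t] by (auto simp: subalgebra_def)
  \<comment> \<open>\<open>V\<close> collects all that is known before the reward of round
    \<open>t\<close>, leaving only \<open>exp (l * rew t \<omega>)\<close> to integrate out.\<close>
  define V where "V \<omega> = ennreal (Z t \<omega> * indicator (A t) \<omega> * exp (- (l * \<mu> (arm t \<omega>)) - l\<^sup>2 / 8))" for \<omega>
  have V: "V \<in> borel_measurable (F t)" unfolding V_def by measurable
  note [measurable] = measurable_M[OF V]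
  have "(\<integral>\<^sup>+\<omega>. ennreal (Z (Suc t) \<omega>) \<partial>M)
      = (\<integral>\<^sup>+\<omega>. ennreal (Z t \<omega> * (1 - indicator (A t) \<omega>)) + V \<omega> * ennreal (exp (l * rew t \<omega>)) \<partial>M)"
  proof (rule nn_integral_cong)
    fix \<omega>
    have "Z (Suc t) \<omega> = Z t \<omega> * exp (indicator (A t) \<omega> * (l * (rew t \<omega> - \<mu> (arm t \<omega>)) - l\<^sup>2 / 8))"
      using step.hyps by (simp add: Z_def exp_add)
    also have "\<dots> = Z t \<omega> * (1 - indicator (A t) \<omega>)
        + Z t \<omega> * indicator (A t) \<omega> * exp (- (l * \<mu> (arm t \<omega>)) - l\<^sup>2 / 8) * exp (l * rew t \<omega>)"
      by (cases "\<omega> \<in> A t") (auto simp: right_diff_distrib mult.assoc simp flip: exp_add)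
    finally show "ennreal (Z (Suc t) \<omega>)
        = ennreal (Z t \<omega> * (1 - indicator (A t) \<omega>)) + V \<omega> * ennreal (exp (l * rew t \<omega>))"
      using Z_pos[of \<omega>] unfolding V_def
      by (simp add: indicator_def ennreal_mult ennreal_plus)
  qed
  also have "\<dots> = (\<integral>\<^sup>+\<omega>. ennreal (Z t \<omega> * (1 - indicator (A t) \<omega>)) \<partial>M)
      + (\<integral>\<^sup>+\<omega>. V \<omega> * ennreal (exp (l * rew t \<omega>)) \<partial>M)"
    by (intro nn_integral_add) measurable
  also have "(\<integral>\<^sup>+\<omega>. V \<omega> * ennreal (exp (l * rew t \<omega>)) \<partial>M)
      = (\<integral>\<^sup>+\<omega>. V \<omega> * (\<integral>\<^sup>+y. ennreal (exp (l * y)) \<partial>P (arm t \<omega>)) \<partial>M)"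
    by (intro nn_integral_reward[OF t V]) measurable
  also have "\<dots> \<le> (\<integral>\<^sup>+\<omega>. ennreal (Z t \<omega> * indicator (A t) \<omega>) \<partial>M)"
  proof (rule nn_integral_mono)
    fix \<omega> assume "\<omega> \<in> space M"
    then have x: "arm t \<omega> \<in> X" using arm_in t by simp
    then have [measurable_cong]: "sets (P (arm t \<omega>)) = sets borel"
      using reward_law by (auto simp: space_prob_algebra)
    let ?I = "\<integral>\<^sup>+y. ennreal (exp (l * (y - \<mu> (arm t \<omega>)))) \<partial>P (arm t \<omega>)"
    have "(\<integral>\<^sup>+y. ennreal (exp (l * y)) \<partial>P (arm t \<omega>))
        = (\<integral>\<^sup>+y. ennreal (exp (l * \<mu> (arm t \<omega>))) * ennreal (exp (l * (y - \<mu> (arm t \<omega>)))) \<partial>P (arm t \<omega>))"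
      by (simp add: algebra_simps flip: ennreal_mult exp_add)
    also have "\<dots> = ennreal (exp (l * \<mu> (arm t \<omega>))) * ?I"
      by (rule nn_integral_cmult) measurable
    finally have "V \<omega> * (\<integral>\<^sup>+y. ennreal (exp (l * y)) \<partial>P (arm t \<omega>))
        = (V \<omega> * ennreal (exp (l * \<mu> (arm t \<omega>)))) * ?I"
      by (simp add: mult.assoc)
    also have "V \<omega> * ennreal (exp (l * \<mu> (arm t \<omega>)))
        = ennreal (Z t \<omega> * indicator (A t) \<omega> * exp (- (l\<^sup>2 / 8)))"
      using Z_pos[of \<omega>] unfolding V_def
      by (subst ennreal_mult[symmetric]) (auto simp: mult.assoc simp flip: exp_add)
    also have "ennreal (Z t \<omega> * indicator (A t) \<omega> * exp (- (l\<^sup>2 / 8))) * ?I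
        \<le> ennreal (Z t \<omega> * indicator (A t) \<omega> * exp (- (l\<^sup>2 / 8))) * ennreal (exp (l\<^sup>2 / 8))"
      by (intro mult_left_mono reward_exp_moment x) auto
    also have "\<dots> = ennreal (Z t \<omega> * indicator (A t) \<omega>)"
      using Z_pos[of \<omega>] by (subst ennreal_mult[symmetric]) (auto simp: mult.assoc simp flip: exp_add)
    finally show "V \<omega> * (\<integral>\<^sup>+y. ennreal (exp (l * y)) \<partial>P (arm t \<omega>)) \<le> ennreal (Z t \<omega> * indicator (A t) \<omega>)" .
  qed
  also have "(\<integral>\<^sup>+\<omega>. ennreal (Z t \<omega> * (1 - indicator (A t) \<omega>)) \<partial>M)
      + (\<integral>\<^sup>+\<omega>. ennreal (Z t \<omega> * indicator (A t) \<omega>) \<partial>M) = (\<integral>\<^sup>+\<omega>. ennreal (Z t \<omega>) \<partial>M)"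
    by (subst nn_integral_add[symmetric]) (auto simp: indicator_def intro!: nn_integral_cong)
  also have "\<dots> \<le> 1"
    using step.IH by (simp add: Z_def)
  finally show ?case
    by (simp add: Z_def add_left_mono)
qed

text \<open>The number of samples is random. Fixing its value \<open>k\<close> inside the event
  makes the compensator l^2 k / 8 deterministic there, so a Chernoff bound applies to the
  supermartingale.\<close>

lemma deviation_prob:
  assumes s: "1 \<le> s" "s \<le> t" and A: "\<And>u. s \<le> u \<Longrightarrow> A u \<in> sets (F u)" and \<epsilon>: "0 < \<epsilon>"
  defines "N \<equiv> \<lambda>\<omega>. \<Sum>u=s..<t. indicator (A u) \<omega> :: real"
    and "S \<equiv> \<lambda>\<omega>. \<Sum>u=s..<t. indicator (A u) \<omega> * (rew u \<omega> - \<mu> (arm u \<omega>))"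
  shows "{\<omega> \<in> space M. N \<omega> = real k \<and> real k * \<epsilon> < \<bar>S \<omega>\<bar>} \<in> sets M"
    and "prob {\<omega> \<in> space M. N \<omega> = real k \<and> real k * \<epsilon> < \<bar>S \<omega>\<bar>} \<le> 2 * exp (- 2 * real k * \<epsilon>\<^sup>2)"
proof -
  have A_M: "A u \<in> sets M" if "s \<le> u" for u
    using A[OF that] subalg[of u] by (auto simp: subalgebra_def)
  have dev_meas: "(\<lambda>\<omega>. rew u \<omega> - \<mu> (arm u \<omega>)) \<in> borel_measurable M" if "s \<le> u" for u
    using that s rew_measurable_M[of u] measurable_M[OF mean_measurable[of u]] by simp
  have [measurable]: "N \<in> borel_measurable M"
    unfolding N_def using A_M by (intro borel_measurable_sum borel_measurable_indicator) simp
  have [measurable]: "S \<in> borel_measurable M"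
    unfolding S_def using A_M dev_meas
    by (intro borel_measurable_sum borel_measurable_times borel_measurable_indicator) simp_all
  show "{\<omega> \<in> space M. N \<omega> = real k \<and> real k * \<epsilon> < \<bar>S \<omega>\<bar>} \<in> sets M"
    by measurable
  have one_sided: "prob {\<omega> \<in> space M. N \<omega> = real k \<and> real k * \<epsilon> < \<sigma> * S \<omega>} \<le> exp (- 2 * real k * \<epsilon>\<^sup>2)"
    (is "prob ?E \<le> ?b")
    if \<sigma>: "\<sigma>\<^sup>2 = 1" for \<sigma> :: real
  proof -
    \<comment> \<open>The size 4 \<open>\<epsilon>\<close> maximises l k \<open>\<epsilon>\<close> -
      l^2 k / 8, with maximum 2 k \<open>\<epsilon>\<close>^2; the sign \<open>\<sigma>\<close>
      selects the tail.\<close>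
    define l where "l = 4 * \<epsilon> * \<sigma>"
    define Z where "Z \<omega> = exp (\<Sum>u=s..<t. indicator (A u) \<omega> * (l * (rew u \<omega> - \<mu> (arm u \<omega>)) - l\<^sup>2 / 8))" for \<omega>
    have Z_eq: "Z \<omega> = exp (l * S \<omega> - l\<^sup>2 / 8 * N \<omega>)" for \<omega>
    proof -
      have "(\<Sum>u=s..<t. indicator (A u) \<omega> * (l * (rew u \<omega> - \<mu> (arm u \<omega>)) - l\<^sup>2 / 8))
          = (\<Sum>u=s..<t. l * (indicator (A u) \<omega> * (rew u \<omega> - \<mu> (arm u \<omega>))) - l\<^sup>2 / 8 * indicator (A u) \<omega>)"
        by (intro sum.cong refl) (simp add: algebra_simps)
      also have "\<dots> = l * S \<omega> - l\<^sup>2 / 8 * N \<omega>"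
        unfolding S_def N_def by (simp only: sum_subtractf sum_distrib_left)
      finally show ?thesis by (simp add: Z_def)
    qed
    have [measurable]: "Z \<in> borel_measurable M"
      unfolding Z_eq[abs_def] by measurable
    have [measurable]: "?E \<in> sets M" by measurable
    have "emeasure M ?E = (\<integral>\<^sup>+\<omega>. indicator ?E \<omega> \<partial>M)"
      by simp
    also have "\<dots> \<le> (\<integral>\<^sup>+\<omega>. ennreal ?b * ennreal (Z \<omega>) \<partial>M)"
    proof (rule nn_integral_mono)
      fix \<omega>
      show "indicator ?E \<omega> \<le> ennreal ?b * ennreal (Z \<omega>)"
      proof (cases "\<omega> \<in> ?E")
        case True
        then have N: "N \<omega> = real k" and S: "real k * \<epsilon> \<le> \<sigma> * S \<omega>" by auto
        have l2: "l\<^sup>2 / 8 = 2 * \<epsilon>\<^sup>2"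
          using \<sigma> by (simp add: l_def power_mult_distrib)
        have "4 * \<epsilon> * (real k * \<epsilon>) \<le> 4 * \<epsilon> * (\<sigma> * S \<omega>)"
          using S \<epsilon> by (intro mult_left_mono) auto
        then have "0 \<le> - 2 * real k * \<epsilon>\<^sup>2 + (l * S \<omega> - l\<^sup>2 / 8 * N \<omega>)"
          unfolding l2 N by (simp add: l_def power2_eq_square algebra_simps)
        then have "1 \<le> ?b * Z \<omega>"
          unfolding Z_eq exp_add[symmetric] by simp
        then have "ennreal 1 \<le> ennreal (?b * Z \<omega>)"
          by (rule ennreal_leI)
        then show ?thesis
          using True by (simp add: ennreal_mult' Z_eq)
      qed simp
    qed
    also have "\<dots> = ennreal ?b * (\<integral>\<^sup>+\<omega>. ennreal (Z \<omega>) \<partial>M)"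
      by (intro nn_integral_cmult) measurable
    also have "\<dots> \<le> ennreal ?b * 1"
      unfolding Z_def by (intro mult_left_mono exp_supermartingale s A) auto
    finally show ?thesis
      by (simp add: emeasure_eq_measure)
  qed
  have "prob {\<omega> \<in> space M. N \<omega> = real k \<and> real k * \<epsilon> < \<bar>S \<omega>\<bar>}
      \<le> prob ({\<omega> \<in> space M. N \<omega> = real k \<and> real k * \<epsilon> < 1 * S \<omega>}
          \<union> {\<omega> \<in> space M. N \<omega> = real k \<and> real k * \<epsilon> < (- 1) * S \<omega>})"
    by (intro finite_measure_mono) (auto simp: abs_if split: if_splits)
  also have "\<dots> \<le> prob {\<omega> \<in> space M. N \<omega> = real k \<and> real k * \<epsilon> < 1 * S \<omega>}
      + prob {\<omega> \<in> space M. N \<omega> = real k \<and> real k * \<epsilon> < (- 1) * S \<omega>}"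
    by (intro measure_Un_le) measurable
  also have "\<dots> \<le> 2 * exp (- 2 * real k * \<epsilon>\<^sup>2)"
    using one_sided[of 1] one_sided[of "- 1"] by simp
  finally show "prob {\<omega> \<in> space M. N \<omega> = real k \<and> real k * \<epsilon> < \<bar>S \<omega>\<bar>} \<le> 2 * exp (- 2 * real k * \<epsilon>\<^sup>2)" .
qed

end

section \<open>Probability that a phase is not clean\<close>

context zooming_run
begin

lemma zooming_phase_run:
  assumes "1 \<le> i" "\<omega> \<in> space M"
  shows "zooming_phase X D \<mu> P i (\<lambda>t. act t \<omega>) (\<lambda>t. arm t \<omega>) (\<lambda>t. rew t \<omega>)"
  using trajectory[OF assms(2)] assms(1)
  by unfold_locales (auto simp: zooming_trajectory_def)

text \<open>An arm activated in a phase is identified by its activation round \<open>s\<close>, so that its plays are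
  events and no measurable structure on \<open>X\<close> is needed.\<close>

definition plays_of :: "nat \<Rightarrow> nat \<Rightarrow> 'w set" where
  "plays_of s u = {\<omega> \<in> space M. act s \<omega> = Some (arm u \<omega>)}"

text \<open>The square root is the confidence radius after \<open>k\<close> plays, and the
  inequality between means is multiplied by \<open>k\<close>.\<close>

definition deviation_event :: "nat \<Rightarrow> nat \<Rightarrow> nat \<Rightarrow> nat \<Rightarrow> 'w set" where
  "deviation_event i s t k = {\<omega> \<in> space M.
     (\<Sum>u=s..<t. indicator (plays_of s u) \<omega>) = real k \<and>
     real k * sqrt (8 * real i / (1 + real k))
       < \<bar>\<Sum>u=s..<t. indicator (plays_of s u) \<omega> * (rew u \<omega> - \<mu> (arm u \<omega>))\<bar>}"

text \<open>\<open>k\<close> starts at 1 because an arm without plays satisfies its confidence bound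
  trivially.\<close>

definition unclean :: "nat \<Rightarrow> 'w set" where
  "unclean i = (\<Union>(s, t, k)\<in>{(s, t, k). s \<in> phase_rounds i \<and> t \<in> phase_rounds i \<and> s \<le> t \<and> k \<in> {1..2 ^ i}}.
     deviation_event i s t k)"

lemma deviation_event_prob:
  assumes i: "1 \<le> i" and s: "1 \<le> s" "s \<le> t" and k: "1 \<le> k"
  shows "deviation_event i s t k \<in> sets M"
    and "prob (deviation_event i s t k) \<le> 2 * exp (- 8 * real i)"
proof -
  define \<epsilon> where "\<epsilon> = sqrt (8 * real i / (1 + real k))"
  have \<epsilon>: "0 < \<epsilon>" using i by (simp add: \<epsilon>_def add_pos_nonneg)
  have A: "plays_of s u \<in> sets (F u)" if "s \<le> u" for u
    unfolding plays_of_def using act_arm_measurable s(1) that by blast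
  show "deviation_event i s t k \<in> sets M"
    unfolding deviation_event_def \<epsilon>_def[symmetric] by (rule deviation_prob(1)[OF s A \<epsilon>])
  have "prob (deviation_event i s t k) \<le> 2 * exp (- 2 * real k * \<epsilon>\<^sup>2)"
    unfolding deviation_event_def \<epsilon>_def[symmetric] by (rule deviation_prob(2)[OF s A \<epsilon>])
  \<comment> \<open>The exponent is 16 i k / (1 + k), and k / (1 + k) >= 1/2 as \<open>k\<close> is
    positive.\<close>
  also have "8 * real i \<le> 2 * real k * \<epsilon>\<^sup>2"
  proof -
    have "8 * real i * (1 + real k) \<le> 8 * real i * (2 * real k)"
      using k by (intro mult_left_mono) auto
    then show ?thesis
      using k by (simp add: \<epsilon>_def field_simps)
  qed
  then have "2 * exp (- 2 * real k * \<epsilon>\<^sup>2) \<le> 2 * exp (- 8 * real i)"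
    by simp
  finally show "prob (deviation_event i s t k) \<le> 2 * exp (- 8 * real i)" .
qed

lemma unclean_prob:
  assumes i: "1 \<le> i"
  shows "unclean i \<in> sets M" and "prob (unclean i) \<le> (1 / 2) ^ i"
proof -
  let ?T = "{(s, t, k). s \<in> phase_rounds i \<and> t \<in> phase_rounds i \<and> s \<le> t \<and> k \<in> {1..2 ^ i :: nat}}"
  have sub: "?T \<subseteq> phase_rounds i \<times> phase_rounds i \<times> {1..2 ^ i}"
    by auto
  have fin: "finite (phase_rounds i \<times> phase_rounds i \<times> {1..2 ^ i :: nat})"
    by (simp add: phase_rounds_def)
  have finT: "finite ?T" by (rule finite_subset[OF sub fin])
  have "card ?T \<le> card (phase_rounds i \<times> phase_rounds i \<times> {1..2 ^ i :: nat})"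
    by (rule card_mono[OF fin sub])
  also have "\<dots> = 8 ^ i"
    by (simp add: card_cartesian_product flip: power_mult_distrib)
  finally have "card ?T \<le> 8 ^ i" .
  from of_nat_mono[OF this, where 'a = real] have cardT: "real (card ?T) \<le> 8 ^ i"
    by simp
  have ev: "deviation_event i s t k \<in> sets M" "prob (deviation_event i s t k) \<le> 2 * exp (- 8 * real i)"
    if "(s, t, k) \<in> ?T" for s t k
    using deviation_event_prob[OF i, of s t k] that phase_rounds_ge_1[of s i] by auto
  show "unclean i \<in> sets M"
    unfolding unclean_def using ev(1) by (intro sets.finite_UN finT) auto
  have "prob (unclean i) \<le> (\<Sum>x\<in>?T. prob (case x of (s, t, k) \<Rightarrow> deviation_event i s t k))"
    unfolding unclean_def using ev(1) by (intro finite_measure_subadditive_finite finT) auto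
  also have "\<dots> \<le> real (card ?T) * (2 * exp (- 8 * real i))"
    using ev(2) by (intro sum_bounded_above) auto
  \<comment> \<open>8 * 2 / 32 = 1/2; the crude bound exp 8 >= 2^8 >= 32 is enough.\<close>
  also have "\<dots> \<le> 8 ^ i * (2 ^ i * (1 / 32) ^ i)"
  proof (intro mult_mono cardT)
    show "(2::real) \<le> 2 ^ i"
      using power_increasing[of 1 i "2::real"] i by simp
    have "(32::real) \<le> 2 ^ 8" by simp
    also have "\<dots> \<le> exp 1 ^ 8"
      using exp_ge_add_one_self[of 1] by (intro power_mono) auto
    finally have "32 \<le> exp (8::real)"
      by (simp flip: exp_of_nat_mult)
    then have "exp (- 8) \<le> (1 / 32 :: real)"
      by (simp add: exp_minus field_simps)
    then have "exp (- 8 :: real) ^ i \<le> (1 / 32) ^ i"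
      by (intro power_mono) auto
    then show "exp (- 8 * real i) \<le> (1 / 32) ^ i"
      by (simp add: mult.commute flip: exp_of_nat_mult)
  qed auto
  also have "\<dots> = (1 / 2) ^ i"
    by (simp flip: power_mult_distrib)
  finally show "prob (unclean i) \<le> (1 / 2) ^ i" .
qed

text \<open>Translates from activation rounds back to arms: if \<open>x\<close> was activated in
  round \<open>s\<close>, then \<open>plays_of s u\<close> says that \<open>x\<close> is played in
  round \<open>u\<close>, and no play of \<open>x\<close> in the phase precedes
  \<open>s\<close>.\<close>

lemma clean_outside_unclean:
  assumes i: "1 \<le> i" and \<omega>: "\<omega> \<in> space M" "\<omega> \<notin> unclean i"
  shows "zooming_phase.clean \<mu> i (\<lambda>t. act t \<omega>) (\<lambda>t. arm t \<omega>) (\<lambda>t. rew t \<omega>)"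
proof -
  let ?act = "\<lambda>t. act t \<omega>" and ?a = "\<lambda>t. arm t \<omega>" and ?y = "\<lambda>t. rew t \<omega>"
  interpret phase: zooming_phase X D \<mu> P i ?act ?a ?y
    by (rule zooming_phase_run[OF i \<omega>(1)])
  have "\<bar>avg_reward i ?a ?y t x - \<mu> x\<bar> \<le> conf_radius i ?a t x"
    if t: "t \<in> phase_rounds i" and x: "x \<in> active_after i ?act t" for t x
  proof -
    obtain s where s: "s \<in> phase_rounds i" "s \<le> t" "act s \<omega> = Some x"
      using x by (auto simp: active_after_def)
    have xX: "x \<in> X" using phase.activated_in_space s by blast
    define n where "n = n_plays i ?a t x"
    have mem: "\<omega> \<in> plays_of s u \<longleftrightarrow> arm u \<omega> = x" for u
      using \<omega>(1) s(3) by (auto simp: plays_of_def)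
    have plays: "plays i ?a t x = {u \<in> {s..<t}. arm u \<omega> = x}"
      using phase.activated_before_played[OF s(1,3)] s(1) t
      by (auto simp: plays_def phase_rounds_def)
    have N: "(\<Sum>u=s..<t. indicator (plays_of s u) \<omega>) = real n"
      unfolding n_def n_plays_def plays indicator_def mem
      by (simp add: sum.If_cases Int_def)
    have S: "(\<Sum>u=s..<t. indicator (plays_of s u) \<omega> * (rew u \<omega> - \<mu> (arm u \<omega>)))
        = (\<Sum>u\<in>plays i ?a t x. rew u \<omega>) - real n * \<mu> x"
    proof -
      have "(\<Sum>u=s..<t. indicator (plays_of s u) \<omega> * (rew u \<omega> - \<mu> (arm u \<omega>)))
          = (\<Sum>u=s..<t. if arm u \<omega> = x then rew u \<omega> - \<mu> x else 0)"
        by (intro sum.cong) (auto simp: indicator_def mem)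
      also have "\<dots> = (\<Sum>u\<in>plays i ?a t x. rew u \<omega> - \<mu> x)"
        unfolding plays by (rule sum.inter_filter[symmetric]) simp
      finally show ?thesis
        by (simp add: sum_subtractf n_def n_plays_def)
    qed
    show ?thesis
    proof (cases "n = 0")
      \<comment> \<open>Without plays the average defaults to 0, and the radius is at least 1, which
        bounds the mean.\<close>
      case True
      then have "conf_radius i ?a t x = sqrt (8 * real i)" "avg_reward i ?a ?y t x = 0"
        by (simp_all add: conf_radius_def avg_reward_def n_def)
      moreover have "1 \<le> sqrt (8 * real i)" using i by simp
      ultimately show ?thesis
        using mu_range[OF xX] unfolding atLeastAtMost_iff by linarith
    next
      case False
      have "n \<le> card (phase_rounds i)"
        unfolding n_def n_plays_def by (rule card_mono) (auto simp: plays_def)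
      then have "\<omega> \<notin> deviation_event i s t n"
        using \<omega>(2) s t False unfolding unclean_def by auto
      then have "\<bar>(\<Sum>u\<in>plays i ?a t x. rew u \<omega>) - real n * \<mu> x\<bar> \<le> real n * conf_radius i ?a t x"
        using \<omega>(1) N S by (simp add: deviation_event_def conf_radius_def n_def)
      moreover have "(\<Sum>u\<in>plays i ?a t x. rew u \<omega>) = real n * avg_reward i ?a ?y t x"
        using False by (simp add: avg_reward_def n_def)
      ultimately have "real n * \<bar>avg_reward i ?a ?y t x - \<mu> x\<bar> \<le> real n * conf_radius i ?a t x"
        by (simp add: abs_mult flip: right_diff_distrib)
      then show ?thesis
        using False by simp
    qed
  qed
  then show ?thesis
    by (simp add: phase.clean_def)
qed

section \<open>Expected power sums of the gaps\<close>

lemma gap_arm_measurable: "1 \<le> s \<Longrightarrow> (\<lambda>\<omega>. gap X \<mu> (arm s \<omega>)) \<in> borel_measurable M"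
  unfolding gap_def using measurable_M[OF mean_measurable[of s]] by simp

lemma gap_arm_powr_integrable:
  assumes "1 \<le> s" "0 < q"
  shows "integrable M (\<lambda>\<omega>. gap X \<mu> (arm s \<omega>) powr q)"
proof (rule integrable_const_bound[where B = 1])
  show "AE \<omega> in M. norm (gap X \<mu> (arm s \<omega>) powr q) \<le> 1"
  proof (rule AE_I2)
    fix \<omega> assume "\<omega> \<in> space M"
    then have "arm s \<omega> \<in> X" using arm_in assms(1) by simp
    then show "norm (gap X \<mu> (arm s \<omega>) powr q) \<le> 1"
      using gap_nonneg gap_le_1 assms(2) by (simp add: powr_le1)
  qed
  show "(\<lambda>\<omega>. gap X \<mu> (arm s \<omega>) powr q) \<in> borel_measurable M"
    using gap_arm_measurable[OF assms(1)] by measurable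
qed

lemma expected_phase_gap_powr:
  assumes i: "1 \<le> i" and cover: "zooming_cover X D \<mu> c d" and d: "0 \<le> d" and c: "0 < c"
  shows "(\<Sum>s\<in>phase_rounds i. expectation (\<lambda>\<omega>. gap X \<mu> (arm s \<omega>) powr ((d + 2) / 2)))
    \<le> 578 * sqrt (c * real i * 2 ^ i)"
proof -
  define q where "q = (d + 2) / 2"
  define K where "K = 577 * sqrt (c * real i * 2 ^ i)"
  note unclean_prob(1)[OF i, measurable]
  have int_unclean: "integrable M (\<lambda>\<omega>. 2 ^ i * sqrt c * indicator (unclean i) \<omega>)"
    by (intro integrable_mult_right integrable_real_indicator) (auto simp: less_top[symmetric])
  have int: "integrable M (\<lambda>\<omega>. gap X \<mu> (arm s \<omega>) powr q)" if "s \<in> phase_rounds i" for s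
    using gap_arm_powr_integrable phase_rounds_ge_1[OF that] d by (simp add: q_def)
  have "(\<Sum>s\<in>phase_rounds i. expectation (\<lambda>\<omega>. gap X \<mu> (arm s \<omega>) powr q))
      = expectation (\<lambda>\<omega>. \<Sum>s\<in>phase_rounds i. gap X \<mu> (arm s \<omega>) powr q)"
    by (rule Bochner_Integration.integral_sum[symmetric]) (rule int)
  also have "\<dots> \<le> expectation (\<lambda>\<omega>. K + 2 ^ i * sqrt c * indicator (unclean i) \<omega>)"
  proof (rule integral_mono)
    show "integrable M (\<lambda>\<omega>. \<Sum>s\<in>phase_rounds i. gap X \<mu> (arm s \<omega>) powr q)"
      by (rule Bochner_Integration.integrable_sum) (rule int)
    show "integrable M (\<lambda>\<omega>. K + 2 ^ i * sqrt c * indicator (unclean i) \<omega>)"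
      by (intro Bochner_Integration.integrable_add integrable_const int_unclean)
    fix \<omega> assume \<omega>: "\<omega> \<in> space M"
    interpret phase: zooming_phase X D \<mu> P i "\<lambda>t. act t \<omega>" "\<lambda>t. arm t \<omega>" "\<lambda>t. rew t \<omega>"
      by (rule zooming_phase_run[OF i \<omega>])
    show "(\<Sum>s\<in>phase_rounds i. gap X \<mu> (arm s \<omega>) powr q) \<le> K + 2 ^ i * sqrt c * indicator (unclean i) \<omega>"
    proof (cases "\<omega> \<in> unclean i")
      case False
      then show ?thesis
        using phase.sum_gap_powr_clean[OF clean_outside_unclean[OF i \<omega> False] cover d c]
        by (simp add: K_def q_def)
    next
      case True
      have "gap X \<mu> (arm s \<omega>) powr q \<le> sqrt c" if "s \<in> phase_rounds i" for s
      proof -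
        have "sqrt (gap X \<mu> (arm s \<omega>) powr (d + 2)) \<le> sqrt c"
          using gap_powr_le_multiplier[OF cover d c phase.played_in_space[OF that]] by simp
        then show ?thesis
          by (simp add: powr_half_sqrt[symmetric] powr_powr q_def)
      qed
      then have "(\<Sum>s\<in>phase_rounds i. gap X \<mu> (arm s \<omega>) powr q) \<le> real (card (phase_rounds i)) * sqrt c"
        by (rule sum_bounded_above)
      moreover have "0 \<le> K" using c by (simp add: K_def)
      ultimately show ?thesis using True by simp
    qed
  qed
  also have "\<dots> = K + 2 ^ i * sqrt c * prob (unclean i)"
    using unclean_prob(1)[OF i]
    by (subst Bochner_Integration.integral_add[OF integrable_const int_unclean]) (simp add: prob_space)
  also have "\<dots> \<le> K + 2 ^ i * sqrt c * (1 / 2) ^ i"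
    using unclean_prob(2)[OF i] c by (intro add_left_mono mult_left_mono) auto
  also have "\<dots> = K + sqrt c"
    by (simp add: power_one_over)
  \<comment> \<open>The share \<open>sqrt c\<close> of the unclean event is absorbed into the main
    term, raising 577 to 578.\<close>
  also have "sqrt c \<le> sqrt (c * real i * 2 ^ i)"
  proof -
    have "1 * 1 \<le> real i * 2 ^ i"
      using i by (intro mult_mono) auto
    then have "c * 1 \<le> c * (real i * 2 ^ i)"
      using c by (intro mult_left_mono) auto
    then show ?thesis by (simp add: mult.assoc)
  qed
  finally show ?thesis by (simp add: K_def q_def)
qed

lemma expected_gap_powr:
  assumes cover: "zooming_cover X D \<mu> c d" and d: "0 \<le> d" and c: "0 < c" and t: "2 \<le> t"
  shows "(\<Sum>s=1..t. expectation (\<lambda>\<omega>. gap X \<mu> (arm s \<omega>) powr ((d + 2) / 2)))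
    \<le> 2312 * sqrt (8 * c * ln (real t) * real t)"
proof -
  define e where "e s = expectation (\<lambda>\<omega>. gap X \<mu> (arm s \<omega>) powr ((d + 2) / 2))" for s
  have e: "0 \<le> e s" for s by (simp add: e_def)
  \<comment> \<open>The first \<open>n\<close> phases end with round 2^(n+1) - 2, which is at least
    \<open>t\<close>; on the other hand 2^n is at most \<open>t + 1\<close>.\<close>
  obtain n where n: "2 ^ n \<le> t + 1" "t + 1 < 2 ^ (n + 1)"
    using ex_power_ivl1[of 2 "t + 1"] by auto
  have "(\<Sum>s=1..t. e s) \<le> (\<Sum>s=1..<phase_start (Suc n). e s)"
    using e n(2) phase_start_eq[of "Suc n"] by (intro sum_mono2) auto
  also have "\<dots> = (\<Sum>i=1..n. \<Sum>s\<in>phase_rounds i. e s)"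
    by (rule sum_phases)
  also have "\<dots> \<le> (\<Sum>i=1..n. 578 * sqrt (c * real n) * sqrt 2 ^ i)"
  proof (rule sum_mono)
    fix i assume i: "i \<in> {1..n}"
    have "(\<Sum>s\<in>phase_rounds i. e s) \<le> 578 * sqrt (c * real i * 2 ^ i)"
      unfolding e_def using i by (intro expected_phase_gap_powr cover d c) auto
    also have "sqrt (c * real i * 2 ^ i) \<le> sqrt (c * real n * 2 ^ i)"
      using i c by simp
    finally show "(\<Sum>s\<in>phase_rounds i. e s) \<le> 578 * sqrt (c * real n) * sqrt 2 ^ i"
      by (simp add: real_sqrt_mult real_sqrt_power)
  qed
  also have "\<dots> = 578 * sqrt (c * real n) * (\<Sum>i=1..n. sqrt 2 ^ i)"
    by (simp add: sum_distrib_left)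
  also have "\<dots> \<le> 578 * sqrt (c * real n) * (4 * sqrt 2 ^ n)"
    using c by (intro mult_left_mono sum_sqrt_two_powers_le) auto
  also have "\<dots> = 2312 * sqrt (c * (real n * 2 ^ n))"
    by (simp add: real_sqrt_mult real_sqrt_power)
  also have "real n * 2 ^ n \<le> (4 * ln (real t)) * (2 * real t)"
  proof (rule mult_mono)
    have pow: "(2::real) ^ n \<le> real t + 1"
      using of_nat_mono[OF n(1), where 'a = real] by simp
    then show "(2::real) ^ n \<le> 2 * real t" using t by simp
    \<comment> \<open>For \<open>t\<close> >= 2 also 2^n <= t + 1 <= t^2, so n / 2 <= n ln 2 <= 2 ln
      t.\<close>
    have "1 / 2 \<le> ln (2::real)"
      using ln_le_minus_one[of "1 / 2 :: real"] by (simp add: ln_div)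
    then have "real n * (1 / 2) \<le> real n * ln 2"
      by (intro mult_left_mono) auto
    also have "\<dots> = ln (2 ^ n)" by (simp add: ln_realpow)
    also have "\<dots> \<le> ln (real t * real t)"
    proof -
      have "real t + 1 \<le> 2 * real t" using t by simp
      also have "\<dots> \<le> real t * real t" using t by (intro mult_right_mono) auto
      finally have "2 ^ n \<le> real t * real t" using pow by linarith
      then show ?thesis by (intro ln_mono) (use t in auto)
    qed
    also have "\<dots> = 2 * ln (real t)" using t by (simp add: ln_mult)
    finally show "real n \<le> 4 * ln (real t)" by simp
  qed (use t in auto)
  then have "sqrt (c * (real n * 2 ^ n)) \<le> sqrt (8 * c * ln (real t) * real t)"
    using c by (simp add: mult_left_mono ac_simps)
  finally show ?thesis by (simp add: e_def)
qed

section \<open>From power sums to regret\<close>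

lemma regret_eq_expected_gap:
  "regret X \<mu> M arm t = (\<Sum>s=1..t. expectation (\<lambda>\<omega>. gap X \<mu> (arm s \<omega>)))"
proof -
  have int: "integrable M (\<lambda>\<omega>. \<mu> (arm s \<omega>))" if s: "1 \<le> s" for s
  proof (rule integrable_const_bound[where B = 1])
    show "AE \<omega> in M. norm (\<mu> (arm s \<omega>)) \<le> 1"
    proof (rule AE_I2)
      fix \<omega> assume "\<omega> \<in> space M"
      then show "norm (\<mu> (arm s \<omega>)) \<le> 1" using mu_range[OF arm_in[OF s]] by auto
    qed
  qed (rule measurable_M[OF mean_measurable[OF s]])
  have "expectation (\<lambda>\<omega>. gap X \<mu> (arm s \<omega>)) = mu_star X \<mu> - expectation (\<lambda>\<omega>. \<mu> (arm s \<omega>))"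
    if "s \<in> {1..t}" for s
    using int[of s] that by (simp add: gap_def prob_space)
  moreover have "expectation (\<lambda>\<omega>. \<Sum>s=1..t. \<mu> (arm s \<omega>)) = (\<Sum>s=1..t. expectation (\<lambda>\<omega>. \<mu> (arm s \<omega>)))"
    using int by (intro Bochner_Integration.integral_sum) auto
  ultimately show ?thesis
    by (simp add: regret_def sum_subtractf)
qed

text \<open>The tangent of \<open>x powr q\<close> is taken at \<open>m\<close>, whose power
  \<open>m powr q\<close> bounds the average expected power of the gaps. The terms t (q - 1) and t
  then add up to t q, and \<open>q\<close> cancels, so no factor depending on \<open>d\<close> is
  left.\<close>

lemma regret_bound:
  assumes cover: "zooming_cover X D \<mu> c d" and d: "0 \<le> d" and c: "0 < c" and t: "2 \<le> t"
  shows "regret X \<mu> M arm t \<le> (8 * 2312\<^sup>2 * c * ln (real t)) powr (1 / (d + 2)) * real t powr ((d + 1) / (d + 2))"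
proof -
  define q where "q = (d + 2) / 2"
  \<comment> \<open>Chosen so that t \<open>sqrt w\<close> is the bound on the power sum;
    \<open>m powr q\<close> = \<open>sqrt w\<close>, and t \<open>m\<close> is the claimed regret
    bound.\<close>
  define w where "w = 8 * 2312\<^sup>2 * c * ln (real t) / real t"
  define m where "m = w powr (1 / (d + 2))"
  have q: "1 \<le> q" using d by (simp add: q_def)
  have w: "0 < w" using c t by (simp add: w_def)
  have m: "0 < m" using w by (simp add: m_def)
  have mq: "m powr q = sqrt w"
    using d w by (simp add: m_def q_def powr_powr powr_half_sqrt)
  have V: "(\<Sum>s=1..t. expectation (\<lambda>\<omega>. gap X \<mu> (arm s \<omega>) powr q)) \<le> real t * m powr q"
  proof -
    have "(real t)\<^sup>2 * w = 2312\<^sup>2 * (8 * c * ln (real t) * real t)"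
      using t by (simp add: w_def power2_eq_square)
    then have "sqrt ((real t)\<^sup>2 * w) = sqrt (2312\<^sup>2 * (8 * c * ln (real t) * real t))"
      by (rule arg_cong)
    then have "real t * sqrt w = 2312 * sqrt (8 * c * ln (real t) * real t)"
      unfolding real_sqrt_mult[of "(real t)\<^sup>2"] real_sqrt_mult[of "2312\<^sup>2"] by simp
    with expected_gap_powr[OF cover d c t] show ?thesis
      unfolding mq by (simp add: q_def)
  qed
  have tangent: "q / m * expectation (\<lambda>\<omega>. gap X \<mu> (arm s \<omega>))
      \<le> q - 1 + expectation (\<lambda>\<omega>. gap X \<mu> (arm s \<omega>) powr q) / m powr q"
    if "s \<in> {1..t}" for s
  proof -
    have s: "1 \<le> s" using that by simp
    have int: "integrable M (\<lambda>\<omega>. gap X \<mu> (arm s \<omega>) powr q)"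
      using gap_arm_powr_integrable[OF s] q by simp
    have int1: "integrable M (\<lambda>\<omega>. gap X \<mu> (arm s \<omega>))"
    proof -
      have "integrable M (\<lambda>\<omega>. gap X \<mu> (arm s \<omega>) powr 1) \<longleftrightarrow> integrable M (\<lambda>\<omega>. gap X \<mu> (arm s \<omega>))"
        using gap_nonneg[OF arm_in[OF s]] by (intro Bochner_Integration.integrable_cong) auto
      then show ?thesis using gap_arm_powr_integrable[OF s, of 1] by simp
    qed
    have "expectation (\<lambda>\<omega>. q / m * gap X \<mu> (arm s \<omega>))
        \<le> expectation (\<lambda>\<omega>. q - 1 + gap X \<mu> (arm s \<omega>) powr q / m powr q)"
    proof (rule integral_mono)
      fix \<omega> assume "\<omega> \<in> space M"
      then have g: "0 \<le> gap X \<mu> (arm s \<omega>)" using gap_nonneg arm_in s by blast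
      show "q / m * gap X \<mu> (arm s \<omega>) \<le> q - 1 + gap X \<mu> (arm s \<omega>) powr q / m powr q"
        using bernoulli_powr[of "gap X \<mu> (arm s \<omega>) / m" q] g m q by (simp add: powr_divide)
    qed (use int int1 in auto)
    then show ?thesis
      using int by (simp add: prob_space)
  qed
  have "q / m * regret X \<mu> M arm t
      = (\<Sum>s=1..t. q / m * expectation (\<lambda>\<omega>. gap X \<mu> (arm s \<omega>)))"
    unfolding regret_eq_expected_gap by (rule sum_distrib_left)
  also have "\<dots> \<le> (\<Sum>s=1..t. q - 1 + expectation (\<lambda>\<omega>. gap X \<mu> (arm s \<omega>) powr q) / m powr q)"
    by (intro sum_mono tangent)
  also have "\<dots> = real t * (q - 1)
      + (\<Sum>s=1..t. expectation (\<lambda>\<omega>. gap X \<mu> (arm s \<omega>) powr q)) / m powr q"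
    by (simp add: sum.distrib sum_divide_distrib)
  also have "\<dots> \<le> real t * (q - 1) + real t"
    using V m by (intro add_left_mono) (simp add: divide_le_eq)
  also have "\<dots> = q / m * (real t * m)"
    using m by (simp add: field_simps)
  finally have "regret X \<mu> M arm t \<le> real t * m"
    by (rule mult_left_le_imp_le) (use q m in auto)
  also have "real t * m = (8 * 2312\<^sup>2 * c * ln (real t)) powr (1 / (d + 2)) * (real t powr 1 / real t powr (1 / (d + 2)))"
    using t c by (simp add: m_def w_def powr_divide)
  also have "real t powr 1 / real t powr (1 / (d + 2)) = real t powr ((d + 1) / (d + 2))"
  proof -
    have "1 - 1 / (d + 2) = (d + 1) / (d + 2)"
      using d by (simp add: field_simps)
    then show ?thesis
      by (simp only: powr_diff[symmetric])
  qed
  finally show ?thesis .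
qed

end

text \<open>\<open>C\<close> is chosen before the instance, hence absolute. Times start at 2 because
  ln 1 = 0 makes the right-hand side vanish at \<open>t\<close> = 1, where the regret can be
  positive.\<close>

theorem theorem4p2:
  shows "\<exists>C>0. \<forall>(X :: 'a set) (D :: 'a \<Rightarrow> 'a \<Rightarrow> real) (\<mu> :: 'a \<Rightarrow> real) (P :: 'a \<Rightarrow> real measure)
           (M :: 'w measure) (F :: nat \<Rightarrow> 'w measure) (arm :: nat \<Rightarrow> 'w \<Rightarrow> 'a)
           (rew :: nat \<Rightarrow> 'w \<Rightarrow> real) (act :: nat \<Rightarrow> 'w \<Rightarrow> 'a option) (c :: real) (d :: real).
           zooming_run X D \<mu> P M F arm rew act \<longrightarrow> 0 < c \<longrightarrow> is_zooming_dimension X D \<mu> c d \<longrightarrow>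
           (\<forall>t::nat. 2 \<le> t \<longrightarrow>
              regret X \<mu> M arm t
                \<le> (C * c * ln (real t)) powr (1 / (d + 2)) * real t powr ((d + 1) / (d + 2)))"
  by (intro exI[of _ "8 * 2312\<^sup>2"])
    (auto simp only: is_zooming_dimension_def intro!: zooming_run.regret_bound, simp)

end
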